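(* The $n$-sphere $S^n$ has a $7$-cubature formula with $O(n^4)$ points for all $n$, more precisely with $4n^4(1+o(1))$ points as $n\to\infty$. For every integer $s\ge 0$, the $3$-sphere $S^3$ has a $(2s+1)$-cubature formula $F$ with $$|F|=\begin{cases}(s+1)(s^2+3) & s\text{ odd},\\ (s+1)(s^2+s+2) & s\text{ even}\end{cases}$$ points.
   Context: $S^n\subset\mathbb{R}^{n+1}$ is the unit sphere with normalized uniform measure $\mu$. A $d$-cubature formula on $S^n$ is a finite set $F=\{p_a\}\subset S^n$ with real weights $w_a$ such that $\int_{S^n}P\,d\mu=\sum_a w_aP(p_a)$ for all polynomials $P$ on $\mathbb{R}^{n+1}$ of degree at most $d$; $|F|$ is the number of points. *)

theory Defs
  imports "HOL-Library.Landau_Symbols" "HOL-Probability.Probability"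
begin

text \<open>
  The dimension \<open>n\<close> is quantified inside the statement, so \<open>\<real>\<^bsup>n+1\<^esup>\<close> is the set of extensional
  functions on the index set \<open>{..n}\<close>, that is, the space of \<open>\<Pi>\<^sub>M i\<in>{..n}. lborel\<close>.
\<close>

definition eucl_norm :: "nat \<Rightarrow> (nat \<Rightarrow> real) \<Rightarrow> real" where
  "eucl_norm n x = sqrt (\<Sum>i\<le>n. (x i)\<^sup>2)"

definition unit_sphere :: "nat \<Rightarrow> (nat \<Rightarrow> real) set" where
  "unit_sphere n = {x \<in> {..n} \<rightarrow>\<^sub>E UNIV. eucl_norm n x = 1}"

definition punctured_ball :: "nat \<Rightarrow> (nat \<Rightarrow> real) set" where
  "punctured_ball n = {x \<in> {..n} \<rightarrow>\<^sub>E UNIV. 0 < eucl_norm n x \<and> eucl_norm n x \<le> 1}"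

definition radial_proj :: "nat \<Rightarrow> (nat \<Rightarrow> real) \<Rightarrow> (nat \<Rightarrow> real)" where
  "radial_proj n x = (\<lambda>i\<in>{..n}. x i / eucl_norm n x)"

text \<open>
  The normalized uniform measure of a set \<open>A\<close> on the sphere is the proportion of the volume of the
  unit ball that is occupied by the cone over \<open>A\<close>. The origin is removed because the radial
  projection is not defined there.
\<close>

definition sphere_measure :: "nat \<Rightarrow> (nat \<Rightarrow> real) measure" where
  "sphere_measure n =
     distr (uniform_measure
              (restrict_space (\<Pi>\<^sub>M i\<in>{..n}. lborel) (punctured_ball n)) (punctured_ball n))
           (restrict_space (\<Pi>\<^sub>M i\<in>{..n}. borel) (unit_sphere n))
           (radial_proj n)"

definition multi_indices :: "nat \<Rightarrow> nat \<Rightarrow> (nat \<Rightarrow> nat) set" where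
  "multi_indices n d = {\<alpha>. (\<forall>i>n. \<alpha> i = 0) \<and> (\<Sum>i\<le>n. \<alpha> i) \<le> d}"

definition poly_deg_le :: "nat \<Rightarrow> nat \<Rightarrow> ((nat \<Rightarrow> real) \<Rightarrow> real) \<Rightarrow> bool" where
  "poly_deg_le n d P \<longleftrightarrow>
     (\<exists>c :: (nat \<Rightarrow> nat) \<Rightarrow> real. \<forall>x. P x = (\<Sum>\<alpha>\<in>multi_indices n d. c \<alpha> * (\<Prod>i\<le>n. x i ^ \<alpha> i)))"

definition is_cubature ::
    "nat \<Rightarrow> nat \<Rightarrow> (nat \<Rightarrow> real) set \<Rightarrow> ((nat \<Rightarrow> real) \<Rightarrow> real) \<Rightarrow> bool" where
  "is_cubature n d F w \<longleftrightarrow>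
     finite F \<and> F \<subseteq> unit_sphere n \<and>
     (\<forall>P. poly_deg_le n d P \<longrightarrow> (\<integral>x. P x \<partial>sphere_measure n) = (\<Sum>p\<in>F. w p * P p))"

lemma finite_multi_indices: "finite (multi_indices n d)"
proof -
  have "multi_indices n d \<subseteq> {f. \<forall>i. (i \<in> {..n} \<longrightarrow> f i \<in> {..d}) \<and> (i \<notin> {..n} \<longrightarrow> f i = 0)}"
  proof (clarsimp simp: multi_indices_def)
    fix \<alpha> :: "nat \<Rightarrow> nat" and i
    assume "sum \<alpha> {..n} \<le> d" "i \<le> n"
    then show "\<alpha> i \<le> d"
      using member_le_sum[of i "{..n}" \<alpha>] by auto
  qed
  moreover have "finite \<dots>"
    by (rule finite_set_of_finite_funs) auto
  ultimately show ?thesis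
    by (rule finite_subset)
qed

lemma eucl_norm_measurable [measurable]:
  "eucl_norm n \<in> borel_measurable (\<Pi>\<^sub>M i\<in>{..n}. lborel)"
  unfolding eucl_norm_def by measurable

lemma punctured_ball_sets: "punctured_ball n \<in> sets (\<Pi>\<^sub>M i\<in>{..n}. lborel)"
proof -
  have "punctured_ball n = {x \<in> space (\<Pi>\<^sub>M i\<in>{..n}. lborel). 0 < eucl_norm n x \<and> eucl_norm n x \<le> 1}"
    by (auto simp: punctured_ball_def space_PiM)
  also have "\<dots> \<in> sets (\<Pi>\<^sub>M i\<in>{..n}. lborel)"
    by measurable
  finally show ?thesis .
qed

lemma emeasure_box:
  assumes "a \<le> (b::real)"
  shows "emeasure (\<Pi>\<^sub>M i\<in>{..n}. lborel) ({..n} \<rightarrow>\<^sub>E {a..b}) = ennreal ((b - a) ^ Suc n)"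
proof -
  interpret finite_product_sigma_finite "\<lambda>_. lborel :: real measure" "{..n}"
    by standard auto
  show ?thesis
    using assms by (subst measure_times) (auto simp: ennreal_power ennreal_mult')
qed

lemma emeasure_punctured_ball_finite:
  "emeasure (\<Pi>\<^sub>M i\<in>{..n}. lborel) (punctured_ball n) \<noteq> \<infinity>"
proof -
  have "punctured_ball n \<subseteq> {..n} \<rightarrow>\<^sub>E {-1..1::real}"
  proof
    fix x assume x: "x \<in> punctured_ball n"
    have "x i \<in> {-1..1::real}" if "i \<le> n" for i
    proof -
      have "(x i)\<^sup>2 \<le> (\<Sum>i\<le>n. (x i)\<^sup>2)"
        using that by (intro member_le_sum) auto
      also have "\<dots> \<le> 1"
        using x by (auto simp: punctured_ball_def eucl_norm_def)
      finally show ?thesis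
        by (auto simp: abs_square_le_1 abs_le_iff)
    qed
    with x show "x \<in> {..n} \<rightarrow>\<^sub>E {-1..1::real}"
      by (auto simp: punctured_ball_def PiE_iff)
  qed
  then have "emeasure (\<Pi>\<^sub>M i\<in>{..n}. lborel) (punctured_ball n)
      \<le> emeasure (\<Pi>\<^sub>M i\<in>{..n}. lborel) ({..n} \<rightarrow>\<^sub>E {-1..1::real})"
    by (rule emeasure_mono) (rule sets_PiM_I_finite, auto)
  also have "\<dots> < \<infinity>"
    by (simp add: emeasure_box)
  finally show ?thesis by simp
qed

lemma emeasure_punctured_ball_nonzero:
  "emeasure (\<Pi>\<^sub>M i\<in>{..n}. lborel) (punctured_ball n) \<noteq> 0"
proof -
  define a :: real where "a = 1 / (2 * real (Suc n))"
  define b :: real where "b = 1 / real (Suc n)"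
  have ab: "0 < a" "a < b" "b \<le> 1"
    by (auto simp: a_def b_def field_simps)
  have "{..n} \<rightarrow>\<^sub>E {a..b} \<subseteq> punctured_ball n"
  proof
    fix x assume x: "x \<in> {..n} \<rightarrow>\<^sub>E {a..b}"
    have xi: "a \<le> x i" "x i \<le> b" if "i \<le> n" for i
      using x that by (auto simp: PiE_iff)
    have "0 < (\<Sum>i\<le>n. (x i)\<^sup>2)"
      using xi ab(1) by (intro sum_pos) (auto, fastforce)
    moreover have "(\<Sum>i\<le>n. (x i)\<^sup>2) \<le> (\<Sum>i\<le>n. b)"
    proof (rule sum_mono)
      fix i assume "i \<in> {..n}"
      then have "0 \<le> x i" "x i \<le> b" using xi[of i] ab by auto
      then have "x i * x i \<le> b * 1" using ab by (intro mult_mono) auto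
      then show "(x i)\<^sup>2 \<le> b" by (simp add: power2_eq_square)
    qed
    moreover have "(\<Sum>i\<le>n. b) = 1"
      by (simp add: b_def)
    ultimately show "x \<in> punctured_ball n"
      using x by (auto simp: punctured_ball_def eucl_norm_def PiE_iff)
  qed
  then have "emeasure (\<Pi>\<^sub>M i\<in>{..n}. lborel) ({..n} \<rightarrow>\<^sub>E {a..b})
      \<le> emeasure (\<Pi>\<^sub>M i\<in>{..n}. lborel) (punctured_ball n)"
    by (intro emeasure_mono punctured_ball_sets)
  moreover have "0 < emeasure (\<Pi>\<^sub>M i\<in>{..n}. lborel) ({..n} \<rightarrow>\<^sub>E {a..b})"
    using ab by (simp add: emeasure_box)
  ultimately show ?thesis
    by (metis leD)
qed

lemma radial_proj_in_unit_sphere: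
  assumes "x \<in> punctured_ball n"
  shows "radial_proj n x \<in> unit_sphere n"
proof -
  have pos: "0 < eucl_norm n x"
    using assms by (simp add: punctured_ball_def)
  have "eucl_norm n (radial_proj n x) = sqrt ((\<Sum>i\<le>n. (x i)\<^sup>2) / (eucl_norm n x)\<^sup>2)"
    unfolding eucl_norm_def[of n "radial_proj n x"] sum_divide_distrib
    by (simp add: radial_proj_def power_divide)
  also have "(eucl_norm n x)\<^sup>2 = (\<Sum>i\<le>n. (x i)\<^sup>2)"
    by (simp add: eucl_norm_def sum_nonneg)
  finally show ?thesis
    using pos by (auto simp: unit_sphere_def radial_proj_def eucl_norm_def)
qed

lemma radial_proj_measurable:
  "radial_proj n \<in> restrict_space (\<Pi>\<^sub>M i\<in>{..n}. lborel) (punctured_ball n)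
     \<rightarrow>\<^sub>M restrict_space (\<Pi>\<^sub>M i\<in>{..n}. borel) (unit_sphere n)"
proof (rule measurable_restrict_space3)
  show "radial_proj n \<in> (\<Pi>\<^sub>M i\<in>{..n}. lborel) \<rightarrow>\<^sub>M (\<Pi>\<^sub>M i\<in>{..n}. borel)"
    unfolding radial_proj_def by measurable
  show "radial_proj n \<in> punctured_ball n \<rightarrow> unit_sphere n"
    using radial_proj_in_unit_sphere by auto
qed

lemma space_sphere_measure: "space (sphere_measure n) = unit_sphere n"
  by (auto simp: sphere_measure_def space_restrict_space space_PiM unit_sphere_def)

lemma prob_space_sphere_measure: "prob_space (sphere_measure n)"
proof -
  let ?M = "restrict_space (\<Pi>\<^sub>M i\<in>{..n}. lborel) (punctured_ball n)"
  have "emeasure ?M (punctured_ball n) = emeasure (\<Pi>\<^sub>M i\<in>{..n}. lborel) (punctured_ball n)"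
    by (rule emeasure_restrict_space)
       (use punctured_ball_sets sets.Int_space_eq2 in \<open>auto simp: punctured_ball_sets\<close>)
  then have "prob_space (uniform_measure ?M (punctured_ball n))"
    using emeasure_punctured_ball_finite emeasure_punctured_ball_nonzero
    by (intro prob_space_uniform_measure) auto
  then show ?thesis
    unfolding sphere_measure_def
    by (rule prob_space.prob_space_distr) (use radial_proj_measurable in simp)
qed

lemma poly_deg_le_integrable:
  assumes "poly_deg_le n d P"
  shows "integrable (sphere_measure n) P"
proof -
  interpret prob_space "sphere_measure n"
    by (rule prob_space_sphere_measure)
  obtain c where P: "P = (\<lambda>x. \<Sum>\<alpha>\<in>multi_indices n d. c \<alpha> * (\<Prod>i\<le>n. x i ^ \<alpha> i))"
    using assms by (auto simp: poly_deg_le_def fun_eq_iff)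
  have "P \<in> borel_measurable (\<Pi>\<^sub>M i\<in>{..n}. borel)"
    unfolding P by measurable
  then have meas: "P \<in> borel_measurable (sphere_measure n)"
    by (simp add: sphere_measure_def measurable_restrict_space1)
  have "\<bar>P x\<bar> \<le> (\<Sum>\<alpha>\<in>multi_indices n d. \<bar>c \<alpha>\<bar>)" if x: "x \<in> unit_sphere n" for x
  proof -
    have xi: "\<bar>x i\<bar> \<le> 1" if "i \<le> n" for i
    proof -
      have "(x i)\<^sup>2 \<le> (\<Sum>i\<le>n. (x i)\<^sup>2)"
        using that by (intro member_le_sum) auto
      also have "\<dots> = 1"
        using x by (simp add: unit_sphere_def eucl_norm_def)
      finally show ?thesis
        by (simp add: abs_square_le_1)
    qed
    have "\<bar>P x\<bar> \<le> (\<Sum>\<alpha>\<in>multi_indices n d. \<bar>c \<alpha> * (\<Prod>i\<le>n. x i ^ \<alpha> i)\<bar>)"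
      unfolding P by (rule sum_abs)
    also have "\<dots> \<le> (\<Sum>\<alpha>\<in>multi_indices n d. \<bar>c \<alpha>\<bar>)"
    proof (rule sum_mono)
      fix \<alpha>
      have "(\<Prod>i\<le>n. \<bar>x i\<bar> ^ \<alpha> i) \<le> 1"
        using xi by (intro prod_le_1) (auto intro: power_le_one)
      then have "\<bar>c \<alpha>\<bar> * (\<Prod>i\<le>n. \<bar>x i\<bar> ^ \<alpha> i) \<le> \<bar>c \<alpha>\<bar> * 1"
        by (rule mult_left_mono) simp
      then show "\<bar>c \<alpha> * (\<Prod>i\<le>n. x i ^ \<alpha> i)\<bar> \<le> \<bar>c \<alpha>\<bar>"
        by (simp add: abs_mult abs_prod power_abs)
    qed
    finally show ?thesis .
  qed
  then show ?thesis
    using meas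
    by (intro integrable_const_bound[where B = "\<Sum>\<alpha>\<in>multi_indices n d. \<bar>c \<alpha>\<bar>"] AE_I2)
       (auto simp: space_sphere_measure)
qed

end

theory Submission
  imports
    Defs
    "HOL-Computational_Algebra.Polynomial"
    "HOL-Real_Asymp.Real_Asymp"
begin

text \<open>
  Both formulas come from averaging over a finite group of isometries. Plane rotations preserve
  Lebesgue measure because they are products of shears, so the spherical integral is invariant under
  them, and under sign changes and transpositions of coordinates. No moment is ever computed.

  Degree 7 on \<open>S\<^sup>n\<close>: the points are \<open>(\<Sum>i\<in>U. \<plusminus>e\<^sub>i) / sqrt |U|\<close> with \<open>1 \<le> |U| \<le> 3\<close>. Monomials with an
  odd exponent vanish on both sides, and since \<open>\<Sum>i. (x i)\<^sup>2 = 1\<close> the others reduce to degree 6. There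
  the integral depends only on the set \<open>V\<close> of the variables that occur, and the value at a point
  belonging to \<open>U\<close> is nonzero exactly if \<open>V \<subseteq> U\<close>, so the weights solve a triangular system. These are
  only \<open>O(n\<^sup>3)\<close> points; points of weight zero bring the number up to \<open>4 n\<^sup>4\<close>.

  Degree \<open>2s + 1\<close> on \<open>S\<^sup>3 \<subseteq> \<complex>\<^sup>2\<close>: with \<open>r = s + 1\<close>, the pairs of \<open>2r\<close>-th roots of unity with equal
  \<open>r\<close>-th powers form a group of order \<open>2r\<^sup>2\<close>, and averaging over it turns every polynomial of degree
  less than \<open>2r\<close> into a polynomial of degree at most \<open>s\<close> in \<open>t = |z\<^sub>1|\<^sup>2\<close>. The latter is integrated by a
  Gauss-Radau rule (\<open>s\<close> even) or a Gauss-Lobatto rule (\<open>s\<close> odd) on \<open>[0, 1]\<close>; at the endpoints \<open>t = 0\<close>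
  and \<open>t = 1\<close> the orbit has only \<open>2r\<close> points.
\<close>

hide_const (open) Finite_Cartesian_Product.transpose

section \<open>Volume-preserving maps\<close>

abbreviation lborel_PiM :: "nat \<Rightarrow> (nat \<Rightarrow> real) measure" where
  "lborel_PiM n \<equiv> \<Pi>\<^sub>M i\<in>{..n}. lborel"

lemma space_lborel_PiM: "space (lborel_PiM n) = {..n} \<rightarrow>\<^sub>E UNIV"
  by (simp add: space_PiM)

lemma sets_PiM_borel: "sets (\<Pi>\<^sub>M i\<in>{..n}. borel :: real measure) = sets (lborel_PiM n)"
  by (rule sets_PiM_cong) simp_all

lemma nn_integral_PiM_section:
  fixes f :: "(nat \<Rightarrow> real) \<Rightarrow> ennreal"
  assumes "i \<le> n" and "f \<in> borel_measurable (lborel_PiM n)"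
  shows "(\<integral>\<^sup>+x. f x \<partial>lborel_PiM n) =
    (\<integral>\<^sup>+x. (\<integral>\<^sup>+y. f (x(i := y)) \<partial>lborel) \<partial>(\<Pi>\<^sub>M i\<in>{..n} - {i}. lborel))"
proof -
  interpret product_sigma_finite "\<lambda>_::nat. lborel :: real measure"
    by standard
  have "insert i ({..n} - {i}) = {..n}"
    using assms(1) by auto
  then show ?thesis
    using product_nn_integral_insert[of "{..n} - {i}" i f] assms(2) by simp
qed

definition vol_preserving :: "nat \<Rightarrow> ((nat \<Rightarrow> real) \<Rightarrow> nat \<Rightarrow> real) \<Rightarrow> bool" where
  "vol_preserving n T \<longleftrightarrow>
     T \<in> lborel_PiM n \<rightarrow>\<^sub>M lborel_PiM n \<and> distr (lborel_PiM n) (lborel_PiM n) T = lborel_PiM n"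

lemma vol_preserving_id: "vol_preserving n id"
  by (simp add: vol_preserving_def id_def)

lemma vol_preserving_comp: "vol_preserving n S \<Longrightarrow> vol_preserving n T \<Longrightarrow> vol_preserving n (S \<circ> T)"
  by (auto simp: vol_preserving_def distr_distr[symmetric])

lemma fun_upd_measurable_PiM:
  assumes i: "i \<le> n" and g: "g \<in> borel_measurable (lborel_PiM n)"
  shows "(\<lambda>x. x(i := g x)) \<in> lborel_PiM n \<rightarrow>\<^sub>M lborel_PiM n"
proof -
  have "(\<lambda>(x, y). x(i := y)) \<in> lborel_PiM n \<Otimes>\<^sub>M lborel \<rightarrow>\<^sub>M lborel_PiM n"
    using measurable_add_dim[of i "{..n}" "\<lambda>_. lborel :: real measure"] i
    by (simp add: insert_absorb)
  from measurable_compose[OF _ this, of "\<lambda>x. (x, g x)"] show ?thesis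
    using g by simp
qed

lemma vol_preserving_coordinate:
  assumes i: "i \<le> n" and e: "\<bar>e\<bar> = 1"
    and h[measurable]: "h \<in> borel_measurable (lborel_PiM n)"
    and h_indep: "\<And>x y. h (x(i := y)) = h x"
  shows "vol_preserving n (\<lambda>x. x(i := e * x i + h x))"
proof -
  let ?M = "lborel_PiM n" and ?M' = "\<Pi>\<^sub>M i\<in>{..n} - {i}. lborel :: real measure"
  define T where "T x = x(i := e * x i + h x)" for x
  have [measurable]: "(\<lambda>x. x i) \<in> borel_measurable ?M"
    using i by simp
  have T[measurable]: "T \<in> ?M \<rightarrow>\<^sub>M ?M"
    unfolding T_def[abs_def] by (rule fun_upd_measurable_PiM[OF i]) measurable
  have "distr ?M ?M T = ?M"
  proof (rule measure_eqI)
    fix A assume "A \<in> sets (distr ?M ?M T)"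
    then have A[measurable]: "A \<in> sets ?M" by simp
    have affine: "(\<integral>\<^sup>+y. indicator A (T (x(i := y))) \<partial>lborel) = (\<integral>\<^sup>+y. indicator A (x(i := y)) \<partial>lborel)"
      if x: "x \<in> space ?M'" for x
    proof -
      have "(\<lambda>y. x(i := y)) \<in> lborel \<rightarrow>\<^sub>M ?M"
        using x i by (intro measurable_fun_upd[where J = "{..n} - {i}"]) auto
      from measurable_compose[OF this borel_measurable_indicator[OF A]]
      have "(\<lambda>y. indicator A (x(i := y)) :: ennreal) \<in> borel_measurable borel"
        by simp
      from nn_integral_real_affine[OF this, of e "h x"] e show ?thesis
        by (simp add: T_def h_indep add.commute)
    qed
    have "emeasure (distr ?M ?M T) A = (\<integral>\<^sup>+x. indicator A (T x) \<partial>?M)"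
      by (simp flip: nn_integral_indicator add: nn_integral_distr)
    also have "\<dots> = (\<integral>\<^sup>+x. (\<integral>\<^sup>+y. indicator A (T (x(i := y))) \<partial>lborel) \<partial>?M')"
      by (rule nn_integral_PiM_section[OF i]) measurable
    also have "\<dots> = (\<integral>\<^sup>+x. (\<integral>\<^sup>+y. indicator A (x(i := y)) \<partial>lborel) \<partial>?M')"
      by (intro nn_integral_cong affine)
    also have "\<dots> = (\<integral>\<^sup>+x. indicator A x \<partial>?M)"
      by (rule nn_integral_PiM_section[OF i, symmetric]) measurable
    finally show "emeasure (distr ?M ?M T) A = emeasure ?M A"
      by simp
  qed simp
  then show ?thesis
    using T by (simp add: vol_preserving_def T_def[abs_def])
qed

definition flip :: "nat \<Rightarrow> (nat \<Rightarrow> real) \<Rightarrow> nat \<Rightarrow> real" where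
  "flip i x = x(i := - x i)"

definition shear :: "nat \<Rightarrow> nat \<Rightarrow> real \<Rightarrow> (nat \<Rightarrow> real) \<Rightarrow> nat \<Rightarrow> real" where
  "shear i j q x = x(i := x i + q * x j)"

definition rot :: "nat \<Rightarrow> nat \<Rightarrow> complex \<Rightarrow> (nat \<Rightarrow> real) \<Rightarrow> nat \<Rightarrow> real" where
  "rot i j u x = x(i := Re u * x i - Im u * x j, j := Im u * x i + Re u * x j)"

lemma vol_preserving_flip:
  assumes "i \<le> n"
  shows "vol_preserving n (flip i)"
  using vol_preserving_coordinate[of i n "-1" "\<lambda>_. 0"] assms by (simp add: flip_def[abs_def])

lemma vol_preserving_shear:
  assumes "i \<le> n" "j \<le> n" "i \<noteq> j"
  shows "vol_preserving n (shear i j q)"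
  using vol_preserving_coordinate[of i n 1 "\<lambda>x. q * x j"] assms by (simp add: shear_def[abs_def])

lemma rot_eq_shears:
  assumes "cmod u = 1" and "Im u \<noteq> 0" and "i \<noteq> j"
  defines "q \<equiv> (Re u - 1) / Im u"
  shows "rot i j u = shear i j q \<circ> shear j i (Im u) \<circ> shear i j q"
proof
  fix x
  have "(Re u)\<^sup>2 + (Im u)\<^sup>2 = 1"
    using assms(1) by (simp add: cmod_def)
  then have "q * Im u = Re u - 1" and "q * (1 + Re u) = - Im u"
    using assms(2) by (auto simp: q_def field_simps power2_eq_square)
  then have Re_u: "Re u = 1 + q * Im u" and Im_u: "Im u = - (q + q * Re u)"
    by (auto simp: algebra_simps)
  have "Re u * x i - Im u * x j = x i + q * x j + q * (x j + Im u * (x i + q * x j))"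
    using Re_u Im_u by algebra
  moreover have "Im u * x i + Re u * x j = x j + Im u * (x i + q * x j)"
    using Re_u by algebra
  ultimately show "rot i j u x = (shear i j q \<circ> shear j i (Im u) \<circ> shear i j q) x"
    using assms(3) by (auto simp: rot_def shear_def)
qed

lemma vol_preserving_rot:
  assumes ij: "i \<le> n" "j \<le> n" "i \<noteq> j" and u: "cmod u = 1"
  shows "vol_preserving n (rot i j u)"
proof (cases "Im u = 0")
  case False
  then show ?thesis
    using ij by (simp add: rot_eq_shears[OF u] vol_preserving_comp vol_preserving_shear)
next
  case True
  then have "\<bar>Re u\<bar> = 1"
    using u by (simp add: cmod_eq_Re)
  then consider "Re u = 1" | "Re u = -1"
    by linarith
  then show ?thesis
  proof cases
    case 1
    then have "rot i j u = id"
      using True by (auto simp: rot_def fun_eq_iff)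
    then show ?thesis
      by (simp add: vol_preserving_id)
  next
    case 2
    then have "rot i j u = flip i \<circ> flip j"
      using True ij by (auto simp: rot_def flip_def fun_eq_iff)
    then show ?thesis
      using ij by (simp add: vol_preserving_comp vol_preserving_flip)
  qed
qed

section \<open>Symmetries of the spherical integral\<close>

lemma integral_uniform_measure:
  fixes f :: "'a \<Rightarrow> real"
  assumes S: "S \<in> sets M" "emeasure M S \<noteq> 0" "emeasure M S \<noteq> \<infinity>" and f: "f \<in> borel_measurable M"
  shows "(\<integral>x. f x \<partial>uniform_measure M S) = (\<integral>x. indicator S x * f x \<partial>M) / measure M S"
proof -
  have "emeasure M S = ennreal (measure M S)" and "0 < measure M S"
    using S by (auto simp: emeasure_eq_ennreal_measure zero_less_measure_iff)
  then have "uniform_measure M S = density M (\<lambda>x. ennreal (indicator S x / measure M S))"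
    unfolding uniform_measure_def
    by (intro density_cong) (use S in \<open>auto simp: divide_ennreal simp flip: ennreal_indicator\<close>)
  then show ?thesis
    using S f by (simp add: integral_density mult.commute)
qed

lemma integral_sphere_measure:
  fixes f :: "(nat \<Rightarrow> real) \<Rightarrow> real"
  assumes f: "f \<in> borel_measurable (lborel_PiM n)"
  shows "(\<integral>x. f x \<partial>sphere_measure n) =
    (\<integral>x. indicator (punctured_ball n) x * f (radial_proj n x) \<partial>lborel_PiM n) /
      measure (lborel_PiM n) (punctured_ball n)"
proof -
  let ?B = "punctured_ball n"
  let ?R = "restrict_space (lborel_PiM n) ?B"
  have B_inter: "?B \<inter> space (lborel_PiM n) = ?B"
    using sets.sets_into_space[OF punctured_ball_sets] by blast
  have B_inter_sets: "?B \<inter> space (lborel_PiM n) \<in> sets (lborel_PiM n)"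
    using punctured_ball_sets by (simp only: B_inter)
  have emeasure_B: "emeasure ?R ?B = emeasure (lborel_PiM n) ?B" and B_sets: "?B \<in> sets ?R"
    using punctured_ball_sets
    by (auto simp: emeasure_restrict_space B_inter_sets sets_restrict_space_iff)
  have "f \<in> borel_measurable (\<Pi>\<^sub>M i\<in>{..n}. borel)"
    using f by (simp add: sets_PiM_borel cong: measurable_cong_sets)
  then have f_borel: "f \<in> borel_measurable (restrict_space (\<Pi>\<^sub>M i\<in>{..n}. borel) (unit_sphere n))"
    by (rule measurable_restrict_space1)
  have "(\<integral>x. f x \<partial>sphere_measure n) = (\<integral>x. f (radial_proj n x) \<partial>uniform_measure ?R ?B)"
    unfolding sphere_measure_def using radial_proj_measurable f_borel
    by (intro integral_distr) simp_all
  also have "\<dots> = (\<integral>x. indicator ?B x * f (radial_proj n x) \<partial>?R) / measure ?R ?B"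
    using measurable_compose[OF radial_proj_measurable f_borel] B_sets emeasure_B
      emeasure_punctured_ball_nonzero emeasure_punctured_ball_finite
    by (intro integral_uniform_measure) auto
  also have "measure ?R ?B = measure (lborel_PiM n) ?B"
    using emeasure_B by (simp add: measure_def)
  also have "(\<integral>x. indicator ?B x * f (radial_proj n x) \<partial>?R) =
      (\<integral>x. indicator ?B x * f (radial_proj n x) \<partial>lborel_PiM n)"
    unfolding integral_restrict_space[OF B_inter_sets]
    by (intro Bochner_Integration.integral_cong refl) (simp split: split_indicator)
  finally show ?thesis .
qed

lemma radial_proj_measurable_PiM: "radial_proj n \<in> lborel_PiM n \<rightarrow>\<^sub>M lborel_PiM n"
  unfolding radial_proj_def by measurable

lemma AE_sphere_measureI:
  assumes P: "{x \<in> space (lborel_PiM n). P x} \<in> sets (lborel_PiM n)"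
    and AE: "AE x in lborel_PiM n. x \<in> punctured_ball n \<longrightarrow> P (radial_proj n x)"
  shows "AE x in sphere_measure n. P x"
proof -
  let ?B = "punctured_ball n"
  let ?R = "restrict_space (lborel_PiM n) ?B"
  let ?N = "restrict_space (\<Pi>\<^sub>M i\<in>{..n}. borel) (unit_sphere n) :: (nat \<Rightarrow> real) measure"
  have "{x \<in> space ?N. P x} = unit_sphere n \<inter> {x \<in> space (lborel_PiM n). P x}"
    by (auto simp: space_restrict_space space_PiM)
  then have meas: "{x \<in> space ?N. P x} \<in> sets ?N"
    using P by (auto simp: sets_restrict_space sets_PiM_borel)
  have B: "?B \<inter> space (lborel_PiM n) \<in> sets (lborel_PiM n)" "?B \<in> sets ?R"
    using punctured_ball_sets[of n] by (auto simp: sets_restrict_space intro: sets.Int)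
  have "AE x in ?R. P (radial_proj n x)"
    using AE by (simp add: AE_restrict_space_iff B)
  then have "AE x in uniform_measure ?R ?B. P (radial_proj n x)"
    by (intro AE_uniform_measureI B) auto
  then show ?thesis
    unfolding sphere_measure_def using radial_proj_measurable
    by (subst AE_distr_iff[OF _ meas]) simp_all
qed

definition sphere_symmetry :: "nat \<Rightarrow> ((nat \<Rightarrow> real) \<Rightarrow> nat \<Rightarrow> real) \<Rightarrow> bool" where
  "sphere_symmetry n T \<longleftrightarrow> vol_preserving n T \<and>
     (\<forall>x. eucl_norm n (T x) = eucl_norm n x \<and> radial_proj n (T x) = T (radial_proj n x))"

lemma sphere_symmetry_measurable: "sphere_symmetry n T \<Longrightarrow> T \<in> lborel_PiM n \<rightarrow>\<^sub>M lborel_PiM n"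
  by (simp add: sphere_symmetry_def vol_preserving_def)

lemma sphere_symmetry_in_space:
  assumes "sphere_symmetry n T" and "x \<in> {..n} \<rightarrow>\<^sub>E UNIV"
  shows "T x \<in> {..n} \<rightarrow>\<^sub>E UNIV"
  using measurable_space[OF sphere_symmetry_measurable[OF assms(1)]] assms(2)
  by (simp add: space_lborel_PiM)

lemma sphere_symmetry_in_sphere:
  assumes "sphere_symmetry n T" and "x \<in> unit_sphere n"
  shows "T x \<in> unit_sphere n"
  using assms sphere_symmetry_in_space[OF assms(1)]
  by (simp add: unit_sphere_def sphere_symmetry_def)

lemma sphere_symmetry_id: "sphere_symmetry n id"
  by (simp add: sphere_symmetry_def vol_preserving_id)

lemma sphere_symmetry_comp:
  assumes "sphere_symmetry n S" and "sphere_symmetry n T"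
  shows "sphere_symmetry n (S \<circ> T)"
  using assms by (simp add: sphere_symmetry_def vol_preserving_comp)

lemma integral_sphere_symmetry:
  fixes f :: "(nat \<Rightarrow> real) \<Rightarrow> real"
  assumes T: "sphere_symmetry n T" and f[measurable]: "f \<in> borel_measurable (lborel_PiM n)"
  shows "(\<integral>x. f (T x) \<partial>sphere_measure n) = (\<integral>x. f x \<partial>sphere_measure n)"
proof -
  let ?M = "lborel_PiM n" and ?B = "punctured_ball n"
  note [measurable] = sphere_symmetry_measurable[OF T] radial_proj_measurable_PiM[of n]
  have [measurable]: "indicator ?B \<in> borel_measurable ?M"
    using punctured_ball_sets by simp
  define g where "g x = indicator ?B x * f (radial_proj n x)" for x
  have g: "g \<in> borel_measurable ?M"
    unfolding g_def[abs_def] by measurable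
  have "T x \<in> ?B \<longleftrightarrow> x \<in> ?B" if "x \<in> space ?M" for x
    using T that sphere_symmetry_in_space[OF T, of x]
    by (simp add: punctured_ball_def sphere_symmetry_def space_lborel_PiM)
  moreover have "T (radial_proj n x) = radial_proj n (T x)" for x
    using T by (simp add: sphere_symmetry_def)
  ultimately have "(\<integral>x. indicator ?B x * f (T (radial_proj n x)) \<partial>?M) = (\<integral>x. g (T x) \<partial>?M)"
    by (intro Bochner_Integration.integral_cong) (simp_all add: g_def indicator_def)
  also have "\<dots> = (\<integral>x. g x \<partial>distr ?M ?M T)"
    by (rule integral_distr[symmetric]) (use g in measurable)
  also have "\<dots> = (\<integral>x. g x \<partial>?M)"
    using T by (simp add: sphere_symmetry_def vol_preserving_def)
  finally show ?thesis
    by (simp add: integral_sphere_measure g_def)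
qed

lemma sphere_symmetry_flip:
  assumes "i \<le> n"
  shows "sphere_symmetry n (flip i)"
proof -
  have "eucl_norm n (flip i x) = eucl_norm n x" for x
    unfolding eucl_norm_def by (intro arg_cong[of _ _ sqrt] sum.cong) (auto simp: flip_def)
  then show ?thesis
    using assms vol_preserving_flip
    by (auto simp: sphere_symmetry_def radial_proj_def flip_def fun_eq_iff)
qed

lemma eucl_norm_rot:
  assumes ij: "i \<le> n" "j \<le> n" "i \<noteq> j" and u: "cmod u = 1"
  shows "eucl_norm n (rot i j u x) = eucl_norm n x"
proof -
  have split: "(\<Sum>k\<le>n. (y k)\<^sup>2) = (y i)\<^sup>2 + (y j)\<^sup>2 + (\<Sum>k\<in>{..n} - {i} - {j}. (y k)\<^sup>2)" for y :: "nat \<Rightarrow> real"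
    using ij by (simp add: sum.remove[of "{..n}" i] sum.remove[of "{..n} - {i}" j])
  have "(rot i j u x i)\<^sup>2 + (rot i j u x j)\<^sup>2 = ((Re u)\<^sup>2 + (Im u)\<^sup>2) * ((x i)\<^sup>2 + (x j)\<^sup>2)"
    using ij(3) by (simp add: rot_def power2_eq_square algebra_simps)
  also have "(Re u)\<^sup>2 + (Im u)\<^sup>2 = 1"
    using u by (simp add: cmod_def)
  finally have "(rot i j u x i)\<^sup>2 + (rot i j u x j)\<^sup>2 = (x i)\<^sup>2 + (x j)\<^sup>2"
    by simp
  moreover have "(\<Sum>k\<in>{..n} - {i} - {j}. (rot i j u x k)\<^sup>2) = (\<Sum>k\<in>{..n} - {i} - {j}. (x k)\<^sup>2)"
    by (intro sum.cong) (auto simp: rot_def)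
  ultimately show ?thesis
    by (simp add: eucl_norm_def split)
qed

lemma sphere_symmetry_rot:
  assumes "i \<le> n" "j \<le> n" "i \<noteq> j" and "cmod u = 1"
  shows "sphere_symmetry n (rot i j u)"
  using assms vol_preserving_rot eucl_norm_rot
  by (auto simp: sphere_symmetry_def radial_proj_def rot_def fun_eq_iff diff_divide_distrib add_divide_distrib)

lemma sphere_symmetry_transpose:
  assumes "i \<le> n" "j \<le> n" "i \<noteq> j"
  shows "sphere_symmetry n (\<lambda>x. x \<circ> transpose i j)"
proof -
  have "(\<lambda>x. x \<circ> transpose i j) = flip i \<circ> rot i j \<i>"
    using assms by (auto simp: flip_def rot_def fun_eq_iff Transposition.transpose_def)
  then show ?thesis
    using assms by (simp add: sphere_symmetry_comp sphere_symmetry_flip sphere_symmetry_rot)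
qed

lemma unit_sphere_sum_squares: "x \<in> unit_sphere n \<Longrightarrow> (\<Sum>i\<le>n. (x i)\<^sup>2) = 1"
  by (simp add: unit_sphere_def eucl_norm_def)

lemma unit_sphere_abs_le_1:
  assumes "x \<in> unit_sphere n" and "i \<le> n"
  shows "\<bar>x i\<bar> \<le> 1"
proof -
  have "(x i)\<^sup>2 \<le> (\<Sum>i\<le>n. (x i)\<^sup>2)"
    using assms(2) by (intro member_le_sum) auto
  then show ?thesis
    by (simp add: unit_sphere_sum_squares[OF assms(1)] abs_square_le_1)
qed

lemma integrable_sphere_measure_bounded:
  fixes f :: "(nat \<Rightarrow> real) \<Rightarrow> real"
  assumes f: "f \<in> borel_measurable (lborel_PiM n)" and K: "\<And>x. x \<in> unit_sphere n \<Longrightarrow> \<bar>f x\<bar> \<le> K"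
  shows "integrable (sphere_measure n) f"
proof -
  interpret prob_space "sphere_measure n"
    by (rule prob_space_sphere_measure)
  have "f \<in> borel_measurable (\<Pi>\<^sub>M i\<in>{..n}. borel)"
    using f by (simp add: sets_PiM_borel cong: measurable_cong_sets)
  then have "f \<in> borel_measurable (sphere_measure n)"
    by (simp add: sphere_measure_def measurable_restrict_space1)
  then show ?thesis
    using K by (intro integrable_const_bound[where B = K]) (auto simp: space_sphere_measure)
qed

abbreviation monomial :: "nat \<Rightarrow> (nat \<Rightarrow> nat) \<Rightarrow> (nat \<Rightarrow> real) \<Rightarrow> real" where
  "monomial n \<alpha> x \<equiv> \<Prod>i\<le>n. x i ^ \<alpha> i"

lemma monomial_measurable: "monomial n \<alpha> \<in> borel_measurable (lborel_PiM n)"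
  by measurable

lemma integrable_monomial_symmetry:
  assumes "sphere_symmetry n T"
  shows "integrable (sphere_measure n) (\<lambda>x. monomial n \<alpha> (T x))"
proof (rule integrable_sphere_measure_bounded[where K = 1])
  show "(\<lambda>x. monomial n \<alpha> (T x)) \<in> borel_measurable (lborel_PiM n)"
    by (rule measurable_compose[OF sphere_symmetry_measurable[OF assms] monomial_measurable])
  fix x assume "x \<in> unit_sphere n"
  then have "T x \<in> unit_sphere n"
    by (rule sphere_symmetry_in_sphere[OF assms])
  then show "\<bar>monomial n \<alpha> (T x)\<bar> \<le> 1"
    unfolding abs_prod power_abs
    by (intro prod_le_1) (auto intro: power_le_one unit_sphere_abs_le_1)
qed

lemma integrable_monomial: "integrable (sphere_measure n) (monomial n \<alpha>)"
  using integrable_monomial_symmetry[OF sphere_symmetry_id] by simp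

lemma integral_odd_monomial:
  assumes i: "i \<le> n" "odd (\<alpha> i)"
  shows "(\<integral>x. monomial n \<alpha> x \<partial>sphere_measure n) = 0"
proof -
  have "monomial n \<alpha> (flip i x) = - monomial n \<alpha> x" for x
  proof -
    have "(\<Prod>k\<in>{..n} - {i}. flip i x k ^ \<alpha> k) = (\<Prod>k\<in>{..n} - {i}. x k ^ \<alpha> k)"
      by (intro prod.cong) (auto simp: flip_def)
    then show ?thesis
      using i by (simp add: prod.remove[of "{..n}" i] flip_def)
  qed
  then show ?thesis
    using integral_sphere_symmetry[OF sphere_symmetry_flip[OF i(1)] monomial_measurable[of \<alpha> n]]
    by simp
qed

lemma monomial_comp_transpose:
  assumes "i \<le> n" "j \<le> n"
  shows "monomial n \<alpha> (x \<circ> transpose i j) = monomial n (\<alpha> \<circ> transpose i j) x"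
  using assms
  by (intro prod.reindex_bij_witness[of _ "transpose i j" "transpose i j"])
     (auto simp: Transposition.transpose_def)

lemma integral_monomial_transpose:
  assumes "i \<le> n" "j \<le> n"
  shows "(\<integral>x. monomial n (\<alpha> \<circ> transpose i j) x \<partial>sphere_measure n) = (\<integral>x. monomial n \<alpha> x \<partial>sphere_measure n)"
proof (cases "i = j")
  case False
  then show ?thesis
    using integral_sphere_symmetry[OF sphere_symmetry_transpose[OF assms False] monomial_measurable[of \<alpha> n]]
    by (simp only: monomial_comp_transpose[OF assms])
qed simp

section \<open>Cubature formulas from weighted families of points\<close>

lemma is_cubature_family:
  fixes h :: "'t \<Rightarrow> real"
  assumes T: "finite T" "g ` T \<subseteq> unit_sphere n"
    and exact: "\<And>\<alpha>. \<alpha> \<in> multi_indices n d \<Longrightarrow>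
      (\<integral>x. monomial n \<alpha> x \<partial>sphere_measure n) = (\<Sum>t\<in>T. h t * monomial n \<alpha> (g t))"
  shows "is_cubature n d (g ` T) (\<lambda>p. \<Sum>t\<in>{t\<in>T. g t = p}. h t)"
  unfolding is_cubature_def
proof (intro conjI allI impI)
  fix P assume "poly_deg_le n d P"
  then obtain c where P: "\<And>x. P x = (\<Sum>\<alpha>\<in>multi_indices n d. c \<alpha> * monomial n \<alpha> x)"
    by (auto simp: poly_deg_le_def)
  have "(\<integral>x. P x \<partial>sphere_measure n) =
      (\<Sum>\<alpha>\<in>multi_indices n d. c \<alpha> * (\<integral>x. monomial n \<alpha> x \<partial>sphere_measure n))"
    unfolding P by (simp add: Bochner_Integration.integral_sum integrable_monomial)
  also have "\<dots> = (\<Sum>\<alpha>\<in>multi_indices n d. c \<alpha> * (\<Sum>t\<in>T. h t * monomial n \<alpha> (g t)))"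
    using exact by simp
  also have "\<dots> = (\<Sum>t\<in>T. h t * P (g t))"
    unfolding P sum_distrib_left by (subst sum.swap) (simp only: mult.left_commute)
  also have "\<dots> = (\<Sum>p\<in>g ` T. \<Sum>t\<in>{t\<in>T. g t = p}. h t * P (g t))"
    by (rule sum.image_gen[OF T(1)])
  also have "\<dots> = (\<Sum>p\<in>g ` T. (\<Sum>t\<in>{t\<in>T. g t = p}. h t) * P p)"
    unfolding sum_distrib_right by (intro sum.cong refl) simp
  finally show "(\<integral>x. P x \<partial>sphere_measure n) = \<dots>" .
qed (use T in auto)

lemma monomial_add_2:
  assumes "i \<le> n"
  shows "monomial n (\<alpha>(i := \<alpha> i + 2)) x = (x i)\<^sup>2 * monomial n \<alpha> x"
proof -
  have "(\<Prod>k\<in>{..n} - {i}. x k ^ (\<alpha>(i := \<alpha> i + 2)) k) = (\<Prod>k\<in>{..n} - {i}. x k ^ \<alpha> k)"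
    by (intro prod.cong) auto
  then show ?thesis
    using assms by (simp add: prod.remove[of "{..n}" i] power2_eq_square)
qed

lemma sum_monomial_add_2:
  assumes "x \<in> unit_sphere n"
  shows "(\<Sum>i\<le>n. monomial n (\<alpha>(i := \<alpha> i + 2)) x) = monomial n \<alpha> x"
proof -
  have "(\<Sum>i\<le>n. monomial n (\<alpha>(i := \<alpha> i + 2)) x) = (\<Sum>i\<le>n. (x i)\<^sup>2 * monomial n \<alpha> x)"
    by (intro sum.cong refl monomial_add_2) simp
  then show ?thesis
    by (simp only: unit_sphere_sum_squares[OF assms] mult_1_left flip: sum_distrib_right)
qed

lemma multi_indices_top_degrees_eq:
  fixes \<Phi> \<Psi> :: "(nat \<Rightarrow> nat) \<Rightarrow> 'a :: comm_monoid_add"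
  assumes \<Phi>: "\<And>\<alpha>. (\<Sum>i\<le>n. \<Phi> (\<alpha>(i := \<alpha> i + 2))) = \<Phi> \<alpha>"
    and \<Psi>: "\<And>\<alpha>. (\<Sum>i\<le>n. \<Psi> (\<alpha>(i := \<alpha> i + 2))) = \<Psi> \<alpha>"
    and top: "\<And>\<alpha>. \<alpha> \<in> multi_indices n d \<Longrightarrow> d \<le> Suc (\<Sum>i\<le>n. \<alpha> i) \<Longrightarrow> \<Phi> \<alpha> = \<Psi> \<alpha>"
    and "\<alpha> \<in> multi_indices n d"
  shows "\<Phi> \<alpha> = \<Psi> \<alpha>"
  using assms(4)
proof (induction "d - (\<Sum>i\<le>n. \<alpha> i)" arbitrary: \<alpha> rule: less_induct)
  case less
  show ?case
  proof (cases "d \<le> Suc (\<Sum>i\<le>n. \<alpha> i)")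
    case True
    with less.prems show ?thesis
      by (rule top)
  next
    case False
    have "\<Phi> (\<alpha>(i := \<alpha> i + 2)) = \<Psi> (\<alpha>(i := \<alpha> i + 2))" if i: "i \<le> n" for i
    proof (rule less.hyps)
      have "(\<Sum>k\<le>n. (\<alpha>(i := \<alpha> i + 2)) k) = (\<Sum>k\<le>n. \<alpha> k) + 2"
        using i by (simp add: sum.remove[of "{..n}" i])
      then show "d - (\<Sum>k\<le>n. (\<alpha>(i := \<alpha> i + 2)) k) < d - (\<Sum>k\<le>n. \<alpha> k)"
        "\<alpha>(i := \<alpha> i + 2) \<in> multi_indices n d"
        using False less.prems i by (auto simp: multi_indices_def)
    qed
    then have "(\<Sum>i\<le>n. \<Phi> (\<alpha>(i := \<alpha> i + 2))) = (\<Sum>i\<le>n. \<Psi> (\<alpha>(i := \<alpha> i + 2)))"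
      by (intro sum.cong refl) blast
    then show ?thesis
      by (simp only: \<Phi> \<Psi>)
  qed
qed

lemma is_cubature_family_top_degrees:
  fixes h :: "'t \<Rightarrow> real"
  assumes T: "finite T" "g ` T \<subseteq> unit_sphere n"
    and exact: "\<And>\<alpha>. \<alpha> \<in> multi_indices n d \<Longrightarrow> d \<le> Suc (\<Sum>i\<le>n. \<alpha> i) \<Longrightarrow>
      (\<integral>x. monomial n \<alpha> x \<partial>sphere_measure n) = (\<Sum>t\<in>T. h t * monomial n \<alpha> (g t))"
  shows "is_cubature n d (g ` T) (\<lambda>p. \<Sum>t\<in>{t\<in>T. g t = p}. h t)"
proof (rule is_cubature_family[OF T])
  let ?I = "\<lambda>\<alpha>. \<integral>x. monomial n \<alpha> x \<partial>sphere_measure n"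
  let ?Q = "\<lambda>\<alpha>. \<Sum>t\<in>T. h t * monomial n \<alpha> (g t)"
  have I: "(\<Sum>i\<le>n. ?I (\<alpha>(i := \<alpha> i + 2))) = ?I \<alpha>" for \<alpha>
  proof -
    have "(\<Sum>i\<le>n. ?I (\<alpha>(i := \<alpha> i + 2))) =
        (\<integral>x. (\<Sum>i\<le>n. monomial n (\<alpha>(i := \<alpha> i + 2)) x) \<partial>sphere_measure n)"
      by (intro Bochner_Integration.integral_sum[symmetric] integrable_monomial)
    also have "\<dots> = ?I \<alpha>"
      by (intro Bochner_Integration.integral_cong)
         (simp_all only: space_sphere_measure sum_monomial_add_2)
    finally show ?thesis .
  qed
  have Q: "(\<Sum>i\<le>n. ?Q (\<alpha>(i := \<alpha> i + 2))) = ?Q \<alpha>" for \<alpha>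
  proof -
    have "(\<Sum>i\<le>n. ?Q (\<alpha>(i := \<alpha> i + 2))) = (\<Sum>t\<in>T. h t * (\<Sum>i\<le>n. monomial n (\<alpha>(i := \<alpha> i + 2)) (g t)))"
      unfolding sum_distrib_left by (rule sum.swap)
    also have "\<dots> = ?Q \<alpha>"
      using T(2) by (intro sum.cong refl) (simp only: sum_monomial_add_2 image_subset_iff)
    finally show ?thesis .
  qed
  show "?I \<alpha> = ?Q \<alpha>" if "\<alpha> \<in> multi_indices n d" for \<alpha>
    using multi_indices_top_degrees_eq[where \<Phi> = ?I and \<Psi> = ?Q, OF I Q exact that] .
qed

lemma infinite_unit_sphere:
  assumes "1 \<le> n"
  shows "infinite (unit_sphere n)"
proof -
  define f :: "real \<Rightarrow> nat \<Rightarrow> real" where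
    "f y = (\<lambda>i\<in>{..n}. if i = 0 then y else if i = 1 then sqrt (1 - y\<^sup>2) else 0)" for y
  have "f ` {0..1} \<subseteq> unit_sphere n"
  proof clarify
    fix y :: real assume "y \<in> {0..1}"
    then have "y\<^sup>2 \<le> 1" by (simp add: power_le_one)
    have "(\<Sum>i\<le>n. (f y i)\<^sup>2) = (\<Sum>i\<in>{0,1}. (f y i)\<^sup>2)"
      using assms by (intro sum.mono_neutral_right) (auto simp: f_def)
    also have "\<dots> = 1"
      using assms \<open>y\<^sup>2 \<le> 1\<close> by (simp add: f_def)
    finally show "f y \<in> unit_sphere n"
      by (simp add: unit_sphere_def eucl_norm_def f_def)
  qed
  moreover have "inj f"
    by (rule inj_on_inverseI[of _ "\<lambda>x. x 0"]) (simp add: f_def)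
  then have "infinite (f ` {0..1})"
    by (simp add: finite_image_iff inj_on_subset)
  ultimately show ?thesis
    using finite_subset by blast
qed

lemma is_cubature_superset:
  assumes F: "is_cubature n d F w" and G: "finite G" "F \<subseteq> G" "G \<subseteq> unit_sphere n"
  shows "is_cubature n d G (\<lambda>p. if p \<in> F then w p else 0)"
proof -
  have "(\<Sum>p\<in>F. w p * P p) = (\<Sum>p\<in>G. (if p \<in> F then w p else 0) * P p)" for P
    using G by (intro sum.mono_neutral_cong_left) auto
  then show ?thesis
    using F G by (simp add: is_cubature_def)
qed

lemma is_cubature_pad:
  assumes F: "is_cubature n d F w" and "1 \<le> n" "card F \<le> N"
  shows "\<exists>F w. is_cubature n d F w \<and> card F = N"
proof -
  have F_sphere: "finite F" "F \<subseteq> unit_sphere n"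
    using F by (auto simp: is_cubature_def)
  then have "infinite (unit_sphere n - F)"
    using infinite_unit_sphere[OF assms(2)] by simp
  then obtain G where G: "finite G" "card G = N - card F" "G \<subseteq> unit_sphere n - F"
    using infinite_arbitrarily_large by metis
  have "is_cubature n d (F \<union> G) (\<lambda>p. if p \<in> F then w p else 0)"
    using F_sphere G by (intro is_cubature_superset[OF F]) auto
  moreover have "card (F \<union> G) = N"
    using F_sphere G assms(3) by (subst card_Un_disjoint) auto
  ultimately show ?thesis by blast
qed

section \<open>Degree 7\<close>

lemma triangular_system:
  fixes m :: "'a :: order \<Rightarrow> 'b :: ab_group_add"
  assumes "finite A"
  shows "\<exists>c. \<forall>v\<in>A. (\<Sum>u | u \<in> A \<and> v \<le> u. c u) = m v"
  using assms
proof (induction A rule: finite_remove_induct)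
  case (remove A)
  obtain a where a: "a \<in> A" and min: "\<And>v. v \<in> A \<Longrightarrow> v \<le> a \<Longrightarrow> v = a"
    using finite_has_minimal[OF remove.hyps(1,2)] by metis
  obtain c where c_solves: "\<And>v. v \<in> A - {a} \<Longrightarrow> (\<Sum>u | u \<in> A - {a} \<and> v \<le> u. c u) = m v"
    using remove.IH[OF a] by blast
  define c' where "c' = c(a := m a - (\<Sum>u | u \<in> A - {a} \<and> a \<le> u. c u))"
  have c'_eq: "(\<Sum>u | u \<in> A - {a} \<and> v \<le> u. c' u) = (\<Sum>u | u \<in> A - {a} \<and> v \<le> u. c u)" for v
    by (intro sum.cong) (auto simp: c'_def)
  have "(\<Sum>u | u \<in> A \<and> v \<le> u. c' u) = m v" if v: "v \<in> A" for v
  proof (cases "v = a")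
    case True
    have "{u. u \<in> A \<and> a \<le> u} = insert a {u. u \<in> A - {a} \<and> a \<le> u}"
      using a by auto
    then show ?thesis
      using True c'_eq[of a] remove.hyps(1) by (simp add: c'_def)
  next
    case False
    then have "{u. u \<in> A \<and> v \<le> u} = {u. u \<in> A - {a} \<and> v \<le> u}"
      using v min by auto
    then show ?thesis
      using v False c'_eq[of v] c_solves[of v] by simp
  qed
  then show ?case by blast
qed simp

abbreviation support :: "(nat \<Rightarrow> nat) \<Rightarrow> nat set" where
  "support \<alpha> \<equiv> {i. 0 < \<alpha> i}"

definition even_indices :: "nat \<Rightarrow> nat \<Rightarrow> (nat \<Rightarrow> nat) set" where
  "even_indices n d = {\<alpha>. (\<forall>i. even (\<alpha> i)) \<and> support \<alpha> \<subseteq> {..n} \<and> (\<Sum>i\<le>n. \<alpha> i) = d}"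

lemma sum_support_even_indices:
  assumes "\<alpha> \<in> even_indices n d"
  shows "(\<Sum>i\<in>support \<alpha>. \<alpha> i) = d"
proof -
  have "(\<Sum>i\<in>support \<alpha>. \<alpha> i) = (\<Sum>i\<le>n. \<alpha> i)"
    using assms by (intro sum.mono_neutral_left) (auto simp: even_indices_def)
  then show ?thesis
    using assms by (simp add: even_indices_def)
qed

lemma sum_eq_imp_ex_less:
  fixes f g :: "'a \<Rightarrow> 'b :: {linorder, ordered_cancel_comm_monoid_add}"
  assumes "finite A" and "(\<Sum>i\<in>A. f i) = (\<Sum>i\<in>A. g i)" and "a \<in> A" "f a \<noteq> g a"
  shows "\<exists>i\<in>A. f i < g i"
proof (rule ccontr)
  assume "\<not> (\<exists>i\<in>A. f i < g i)"
  then have "\<forall>i\<in>A. g i \<le> f i" by force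
  then have "(\<Sum>i\<in>A. g i) < (\<Sum>i\<in>A. f i)"
    using assms
    by (intro sum_strict_mono_ex1) (auto intro!: bexI[of _ a] order.not_eq_order_implies_strict)
  then show False
    using assms(2) by simp
qed

lemma even_indices_6_less:
  assumes \<alpha>: "\<alpha> \<in> even_indices n 6" and \<beta>: "\<beta> \<in> even_indices n 6"
    and supp: "support \<alpha> = support \<beta>" and ij: "\<beta> i < \<alpha> i" "\<alpha> j < \<beta> j"
  shows "\<alpha> = (\<lambda>_. 0)(i := 4, j := 2)"
proof -
  have even: "even (\<alpha> k)" "even (\<beta> k)" for k
    using \<alpha> \<beta> by (simp_all add: even_indices_def)
  have supp_iff: "0 < \<alpha> k \<longleftrightarrow> 0 < \<beta> k" for k
    using supp by blast
  have \<alpha>_ij: "4 \<le> \<alpha> i" "2 \<le> \<alpha> j"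
    using ij even[of i] even[of j] supp_iff[of i] supp_iff[of j] by presburger+
  have fin: "finite (support \<alpha>)"
    using \<alpha> finite_subset[of _ "{..n}"] by (simp add: even_indices_def)
  have "i \<noteq> j" and "{i, j} \<subseteq> support \<alpha>"
    using ij \<alpha>_ij by auto
  then have "(\<Sum>k\<in>support \<alpha>. \<alpha> k) = (\<Sum>k\<in>support \<alpha> - {i, j}. \<alpha> k) + (\<alpha> i + \<alpha> j)"
    using fin by (subst sum.subset_diff[of "{i, j}"]) simp_all
  moreover have "(\<Sum>k\<in>support \<alpha>. \<alpha> k) = 6"
    using \<alpha> by (rule sum_support_even_indices)
  ultimately have exponents: "\<alpha> i = 4" "\<alpha> j = 2" and "(\<Sum>k\<in>support \<alpha> - {i, j}. \<alpha> k) = 0"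
    using \<alpha>_ij by linarith+
  then have "\<alpha> k = 0" if "k \<noteq> i" "k \<noteq> j" for k
    using that fin by auto
  then show ?thesis
    using exponents \<open>i \<noteq> j\<close> by (auto simp: fun_eq_iff)
qed

text \<open>Degree 6 is special here: in degree 8, the exponents \<open>(4, 4)\<close> and \<open>(6, 2)\<close> have equal support.\<close>

lemma even_indices_6_same_support:
  assumes "\<alpha> \<in> even_indices n 6" and "\<beta> \<in> even_indices n 6" and supp: "support \<alpha> = support \<beta>"
  shows "\<exists>i\<le>n. \<exists>j\<le>n. \<beta> = \<alpha> \<circ> transpose i j"
proof (cases "\<alpha> = \<beta>")
  case True
  then show ?thesis
    by (intro exI[of _ 0]) auto
next
  case False
  then obtain k where k: "\<alpha> k \<noteq> \<beta> k" by blast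
  have "\<alpha> k = 0" "\<beta> k = 0" if "n < k"
    using assms(1,2) that by (force simp: even_indices_def)+
  then have "k \<in> {..n}"
    using k by fastforce
  have "(\<Sum>k\<le>n. \<alpha> k) = (\<Sum>k\<le>n. \<beta> k)"
    using assms by (simp add: even_indices_def)
  then have "\<exists>i\<in>{..n}. \<beta> i < \<alpha> i" "\<exists>j\<in>{..n}. \<alpha> j < \<beta> j"
    using k \<open>k \<in> {..n}\<close> by (auto intro!: sum_eq_imp_ex_less)
  then obtain i j where ij: "i \<le> n" "\<beta> i < \<alpha> i" "j \<le> n" "\<alpha> j < \<beta> j"
    by auto
  then have "\<alpha> = (\<lambda>_. 0)(i := 4, j := 2)" "\<beta> = (\<lambda>_. 0)(j := 4, i := 2)"
    using even_indices_6_less[OF assms ij(2,4)] even_indices_6_less[OF assms(2,1) supp[symmetric] ij(4,2)]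
    by simp_all
  then have "\<beta> = \<alpha> \<circ> transpose i j"
    using ij by (auto simp: fun_eq_iff Transposition.transpose_def)
  then show ?thesis
    using ij by blast
qed

lemma integral_monomial_6_factors_support:
  "\<exists>m. \<forall>\<alpha>\<in>even_indices n 6. (\<integral>x. monomial n \<alpha> x \<partial>sphere_measure n) = m (support \<alpha>)"
proof -
  let ?I = "\<lambda>\<alpha>. \<integral>x. monomial n \<alpha> x \<partial>sphere_measure n"
  have "?I \<alpha> = ?I \<beta>"
    if \<alpha>\<beta>: "\<alpha> \<in> even_indices n 6" "\<beta> \<in> even_indices n 6" "support \<alpha> = support \<beta>" for \<alpha> \<beta>
  proof -
    obtain i j where "i \<le> n" "j \<le> n" "\<beta> = \<alpha> \<circ> transpose i j"
      using even_indices_6_same_support[OF \<alpha>\<beta>] by blast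
    then show ?thesis
      using integral_monomial_transpose[of i n j \<alpha>] by simp
  qed
  then show ?thesis
    using function_factors_left_gen[of "\<lambda>\<alpha>. \<alpha> \<in> even_indices n 6" support ?I] by blast
qed

definition sign_point :: "nat \<Rightarrow> nat set \<Rightarrow> nat set \<Rightarrow> nat \<Rightarrow> real" where
  "sign_point n U S = (\<lambda>i\<in>{..n}. if i \<in> U then (if i \<in> S then -1 else 1) / sqrt (card U) else 0)"

lemma sign_point_square:
  assumes "i \<le> n"
  shows "(sign_point n U S i)\<^sup>2 = (if i \<in> U then 1 / card U else 0)"
  using assms by (simp add: sign_point_def power_divide)

lemma sign_point_in_sphere:
  assumes "U \<subseteq> {..n}" "U \<noteq> {}"
  shows "sign_point n U S \<in> unit_sphere n"
proof -
  have "(\<Sum>i\<le>n. (sign_point n U S i)\<^sup>2) = (\<Sum>i\<in>U. 1 / card U)"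
    using assms(1) by (simp add: sign_point_square sum.If_cases Int_absorb1)
  also have "\<dots> = 1"
    using assms(2) finite_subset[OF assms(1)] by simp
  finally show ?thesis
    by (auto simp: unit_sphere_def eucl_norm_def sign_point_def)
qed

lemma monomial_sign_point_even:
  assumes \<alpha>: "\<alpha> \<in> even_indices n (2 * d)"
  shows "monomial n \<alpha> (sign_point n U S) = (if support \<alpha> \<subseteq> U then 1 / real (card U) ^ d else 0)"
proof (cases "support \<alpha> \<subseteq> U")
  case True
  have half: "\<alpha> i = 2 * (\<alpha> i div 2)" for i
    using \<alpha> by (simp add: even_indices_def)
  have "sign_point n U S i ^ \<alpha> i = (1 / card U) ^ (\<alpha> i div 2)" if "i \<le> n" for i
  proof (cases "i \<in> U")
    case False
    with True have "\<alpha> i = 0" by auto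
    then show ?thesis by simp
  next
    case True
    then show ?thesis
      using sign_point_square[OF that, of U S] by (subst half) (simp only: power_mult if_True)
  qed
  then have "monomial n \<alpha> (sign_point n U S) = (1 / card U) ^ (\<Sum>i\<le>n. \<alpha> i div 2)"
    by (simp add: power_sum)
  also have "(\<Sum>i\<le>n. \<alpha> i div 2) = d"
  proof -
    have "2 * (\<Sum>i\<le>n. \<alpha> i div 2) = (\<Sum>i\<le>n. \<alpha> i)"
      unfolding sum_distrib_left by (simp only: half[symmetric])
    then show ?thesis
      using \<alpha> by (simp add: even_indices_def)
  qed
  finally show ?thesis
    using True by (simp add: power_divide)
next
  case False
  then obtain i where "i \<notin> U" "0 < \<alpha> i" by blast
  moreover from this(2) have "i \<le> n"
    using \<alpha> by (auto simp: even_indices_def)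
  ultimately have "monomial n \<alpha> (sign_point n U S) = 0"
    by (intro prod_zero bexI[of _ i]) (auto simp: sign_point_def)
  then show ?thesis
    using False by simp
qed

lemma sum_monomial_sign_point_odd:
  assumes i: "i \<le> n" "odd (\<alpha> i)"
  shows "(\<Sum>S\<in>Pow U. monomial n \<alpha> (sign_point n U S)) = 0"
proof (cases "i \<in> U")
  case False
  then have "monomial n \<alpha> (sign_point n U S) = 0" for S
    using i by (intro prod_zero bexI[of _ i]) (auto simp: sign_point_def odd_pos)
  then show ?thesis
    by (simp only: sum.neutral_const)
next
  case True
  define toggle where "toggle S = sym_diff S {i}" for S
  have "monomial n \<alpha> (sign_point n U (toggle S)) = - monomial n \<alpha> (sign_point n U S)" for S
  proof -
    have "(\<Prod>k\<in>{..n} - {i}. sign_point n U (toggle S) k ^ \<alpha> k) =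
        (\<Prod>k\<in>{..n} - {i}. sign_point n U S k ^ \<alpha> k)"
      by (intro prod.cong refl) (auto simp: sign_point_def toggle_def)
    moreover have "sign_point n U (toggle S) i = - sign_point n U S i"
      using True i by (auto simp: sign_point_def toggle_def)
    ultimately show ?thesis
      using i by (simp add: prod.remove[of "{..n}" i])
  qed
  moreover have "(\<Sum>S\<in>Pow U. monomial n \<alpha> (sign_point n U (toggle S))) =
      (\<Sum>S\<in>Pow U. monomial n \<alpha> (sign_point n U S))"
    using True by (intro sum.reindex_bij_witness[of _ toggle toggle]) (auto simp: toggle_def)
  ultimately show ?thesis
    by (simp add: sum_negf)
qed

definition small_sets :: "nat \<Rightarrow> nat set set" where
  "small_sets n = {U. U \<subseteq> {..n} \<and> U \<noteq> {} \<and> card U \<le> 3}"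

lemma small_setsD:
  assumes "U \<in> small_sets n"
  shows "U \<subseteq> {..n}" "U \<noteq> {}" "finite U" "card U \<le> 3" "0 < card U"
  using assms finite_subset[of U "{..n}"] by (auto simp: small_sets_def card_gt_0_iff)

lemma finite_small_sets: "finite (small_sets n)"
  by (rule finite_subset[of _ "Pow {..n}"]) (auto simp: small_sets_def)

lemma card_small_sets: "card (small_sets n) \<le> 3 * (n + 1) ^ 3"
proof -
  have card_eq: "card {U. U \<subseteq> {..n} \<and> card U = k} \<le> (n + 1) ^ 3" if "k \<le> 3" for k
  proof (cases "k \<le> n + 1")
    case True
    have "card {U. U \<subseteq> {..n} \<and> card U = k} = (n + 1) choose k"
      by (simp add: n_subsets)
    also have "\<dots> \<le> (n + 1) ^ k"
      by (rule binomial_le_pow[OF True])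
    also have "\<dots> \<le> (n + 1) ^ 3"
      using that by (intro power_increasing) auto
    finally show ?thesis .
  qed (simp add: n_subsets binomial_eq_0)
  have "small_sets n \<subseteq> (\<Union>k\<in>{1..3}. {U. U \<subseteq> {..n} \<and> card U = k})"
  proof
    fix U assume "U \<in> small_sets n"
    then show "U \<in> (\<Union>k\<in>{1..3}. {U. U \<subseteq> {..n} \<and> card U = k})"
      using small_setsD(1,4,5)[of U n] by auto
  qed
  then have "card (small_sets n) \<le> card (\<Union>k\<in>{1..3}. {U. U \<subseteq> {..n} \<and> card U = k})"
    by (intro card_mono) auto
  also have "\<dots> \<le> (\<Sum>k\<in>{1..3}. card {U. U \<subseteq> {..n} \<and> card U = k})"
    by (rule card_UN_le) simp
  also have "\<dots> \<le> (\<Sum>k\<in>{1..3::nat}. (n + 1) ^ 3)"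
    by (intro sum_mono card_eq) simp
  finally show ?thesis by simp
qed

lemma support_in_small_sets:
  assumes "\<alpha> \<in> even_indices n 6"
  shows "support \<alpha> \<in> small_sets n"
proof -
  have sum: "(\<Sum>i\<in>support \<alpha>. \<alpha> i) = 6"
    using assms by (rule sum_support_even_indices)
  have "of_nat (card (support \<alpha>)) * 2 \<le> (\<Sum>i\<in>support \<alpha>. \<alpha> i)"
  proof (rule sum_bounded_below)
    fix i assume "i \<in> support \<alpha>"
    moreover have "even (\<alpha> i)"
      using assms by (simp add: even_indices_def)
    ultimately show "2 \<le> \<alpha> i"
      by (auto elim: evenE)
  qed
  moreover have "support \<alpha> \<noteq> {}"
    using sum by (metis sum.empty zero_neq_numeral)
  ultimately show ?thesis
    using assms sum by (simp add: small_sets_def even_indices_def)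
qed

definition sign_patterns :: "nat \<Rightarrow> (nat set \<times> nat set) set" where
  "sign_patterns n = Sigma (small_sets n) Pow"

lemma finite_sign_patterns: "finite (sign_patterns n)"
  using finite_small_sets small_setsD(3) by (auto simp: sign_patterns_def)

lemma sum_sign_patterns: "(\<Sum>(U, S)\<in>sign_patterns n. f U S) = (\<Sum>U\<in>small_sets n. \<Sum>S\<in>Pow U. f U S)"
  unfolding sign_patterns_def
  by (rule sum.Sigma[symmetric]) (auto simp: finite_small_sets small_setsD)

lemma card_sign_patterns: "card (sign_patterns n) \<le> 24 * (n + 1) ^ 3"
proof -
  have "card (sign_patterns n) = (\<Sum>U\<in>small_sets n. 2 ^ card U)"
    unfolding sign_patterns_def
    by (subst card_SigmaI) (auto simp: finite_small_sets small_setsD card_Pow)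
  also have "\<dots> \<le> (\<Sum>U\<in>small_sets n. 2 ^ 3)"
    by (intro sum_mono power_increasing) (auto simp: small_setsD)
  also have "\<dots> \<le> 24 * (n + 1) ^ 3"
    using card_small_sets[of n] by simp
  finally show ?thesis .
qed

lemma sum_sign_patterns_even_6:
  fixes c :: "nat set \<Rightarrow> real"
  assumes \<alpha>: "\<alpha> \<in> even_indices n 6"
  shows "(\<Sum>(U, S)\<in>sign_patterns n. c U * card U ^ 3 / 2 ^ card U * monomial n \<alpha> (sign_point n U S)) =
    (\<Sum>U | U \<in> small_sets n \<and> support \<alpha> \<subseteq> U. c U)"
proof -
  have "(\<Sum>S\<in>Pow U. c U * card U ^ 3 / 2 ^ card U * monomial n \<alpha> (sign_point n U S)) =
      (if support \<alpha> \<subseteq> U then c U else 0)" if "U \<in> small_sets n" for U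
    using small_setsD[OF that] monomial_sign_point_even[of \<alpha> n 3 U] \<alpha> by (simp add: card_Pow)
  then have "(\<Sum>(U, S)\<in>sign_patterns n. c U * card U ^ 3 / 2 ^ card U * monomial n \<alpha> (sign_point n U S)) =
      (\<Sum>U\<in>small_sets n. if support \<alpha> \<subseteq> U then c U else 0)"
    unfolding sum_sign_patterns by (intro sum.cong refl)
  then show ?thesis
    by (simp add: sum.inter_filter finite_small_sets)
qed

lemma sum_sign_patterns_odd:
  fixes c :: "nat set \<Rightarrow> real"
  assumes "i \<le> n" and "odd (\<alpha> i)"
  shows "(\<Sum>(U, S)\<in>sign_patterns n. c U * monomial n \<alpha> (sign_point n U S)) = 0"
  unfolding sum_sign_patterns
  by (simp add: sum_monomial_sign_point_odd[where \<alpha> = \<alpha>, OF assms] flip: sum_distrib_left)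

lemma exists_cubature_7: "\<exists>F w. is_cubature n 7 F w \<and> card F \<le> 24 * (n + 1) ^ 3"
proof -
  obtain m where moments: "\<And>\<alpha>. \<alpha> \<in> even_indices n 6 \<Longrightarrow>
      (\<integral>x. monomial n \<alpha> x \<partial>sphere_measure n) = m (support \<alpha>)"
    using integral_monomial_6_factors_support by blast
  obtain c where weights: "\<And>V. V \<in> small_sets n \<Longrightarrow> (\<Sum>U | U \<in> small_sets n \<and> V \<subseteq> U. c U) = m V"
    using triangular_system[OF finite_small_sets, of n m] by blast
  define g where "g = (\<lambda>(U, S). sign_point n U S)"
  define h where "h = (\<lambda>(U, S :: nat set). c U * card U ^ 3 / 2 ^ card U)"
  have "(\<integral>x. monomial n \<alpha> x \<partial>sphere_measure n) = (\<Sum>t\<in>sign_patterns n. h t * monomial n \<alpha> (g t))"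
    if \<alpha>: "\<alpha> \<in> multi_indices n 7" "7 \<le> Suc (\<Sum>i\<le>n. \<alpha> i)" for \<alpha>
  proof (cases "\<forall>i. even (\<alpha> i)")
    case True
    then have "even (\<Sum>i\<le>n. \<alpha> i)"
      by (intro dvd_sum) auto
    then have "(\<Sum>i\<le>n. \<alpha> i) = 6"
      using \<alpha> by (auto simp: multi_indices_def elim!: evenE)
    then have "\<alpha> \<in> even_indices n 6"
      using True \<alpha> by (auto simp: even_indices_def multi_indices_def not_less[symmetric])
    then show ?thesis
      using sum_sign_patterns_even_6[of \<alpha> n c] moments weights[OF support_in_small_sets]
      by (simp add: g_def h_def case_prod_unfold)
  next
    case False
    then obtain i where "odd (\<alpha> i)" by blast
    moreover from this have "i \<le> n"
      using \<alpha> by (auto simp: multi_indices_def not_less[symmetric] intro: ccontr)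
    ultimately show ?thesis
      using sum_sign_patterns_odd[of i n \<alpha> "\<lambda>U. c U * card U ^ 3 / 2 ^ card U"] integral_odd_monomial[of i n \<alpha>]
      by (simp add: g_def h_def case_prod_unfold)
  qed
  moreover have "g ` sign_patterns n \<subseteq> unit_sphere n"
    by (auto simp: g_def sign_patterns_def small_sets_def intro!: sign_point_in_sphere)
  ultimately have "is_cubature n 7 (g ` sign_patterns n) (\<lambda>p. \<Sum>t\<in>{t\<in>sign_patterns n. g t = p}. h t)"
    by (intro is_cubature_family_top_degrees finite_sign_patterns)
  moreover have "card (g ` sign_patterns n) \<le> 24 * (n + 1) ^ 3"
    using card_image_le[OF finite_sign_patterns] card_sign_patterns by (rule order_trans)
  ultimately show ?thesis by blast
qed

lemma Suc_cube_le_pow4: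
  fixes n :: nat
  assumes "1 \<le> n"
  shows "(n + 1) ^ 3 \<le> 8 * n ^ 4"
proof -
  have "(n + 1) ^ 3 \<le> (2 * n) ^ 3"
    using assms by (intro power_mono) auto
  also have "\<dots> \<le> 8 * n ^ 4"
    using assms by (simp add: power_mult_distrib power_increasing)
  finally show ?thesis .
qed

lemma cubature_7_asymptotic:
  "\<exists>N :: nat \<Rightarrow> nat.
      (\<forall>n. \<exists>F w. is_cubature n 7 F w \<and> card F = N n) \<and>
      (\<exists>C :: real. \<forall>n\<ge>1. real (N n) \<le> C * real n ^ 4) \<and>
      (\<lambda>n. real (N n)) \<sim>[at_top] (\<lambda>n. 4 * real n ^ 4)"
proof -
  obtain F w where F: "\<And>n. is_cubature n 7 (F n) (w n)" and card_F: "\<And>n. card (F n) \<le> 24 * (n + 1) ^ 3"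
    using exists_cubature_7 by metis
  define N where "N n = max (card (F n)) (4 * n ^ 4)" for n
  have "\<exists>F w. is_cubature n 7 F w \<and> card F = N n" for n
  proof (cases "n = 0")
    case True
    then show ?thesis
      using F by (auto simp: N_def)
  next
    case False
    then show ?thesis
      using is_cubature_pad[OF F] by (simp add: N_def)
  qed
  moreover have "real (N n) \<le> 192 * real n ^ 4" if "n \<ge> 1" for n
  proof -
    have "N n \<le> 192 * n ^ 4"
      using card_F[of n] Suc_cube_le_pow4[OF that] by (simp add: N_def)
    then show ?thesis
      by (simp flip: of_nat_le_iff[where 'a = real])
  qed
  moreover have "(\<lambda>n. real (N n)) \<sim>[at_top] (\<lambda>n. 4 * real n ^ 4)"
  proof (rule asymp_equiv_refl_ev)
    have "eventually (\<lambda>n. 24 * (real n + 1) ^ 3 \<le> 4 * real n ^ 4) at_top"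
      by real_asymp
    then show "eventually (\<lambda>n. real (N n) = 4 * real n ^ 4) at_top"
    proof eventually_elim
      case (elim n)
      then have "24 * (n + 1) ^ 3 \<le> 4 * n ^ 4"
        by (simp flip: of_nat_le_iff[where 'a = real] add: add.commute)
      then show ?case
        using card_F[of n] by (simp add: N_def max_def)
    qed
  qed
  ultimately show ?thesis by blast
qed

section \<open>Gauss quadrature\<close>

lemma lagrange_interpolation:
  fixes A :: "'a :: field set"
  assumes "finite A"
  shows "\<exists>l. \<forall>f. degree f < card A \<longrightarrow> f = (\<Sum>a\<in>A. smult (poly f a) (l a))"
proof -
  define node where "node a = (\<Prod>b\<in>A - {a}. [:-b, 1:])" for a
  define l where "l a = smult (1 / poly (node a) a) (node a)" for a
  have "poly (node a) a \<noteq> 0" for a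
    using assms by (simp add: node_def poly_prod)
  then have l_values: "poly (l a) b = (if a = b then 1 else 0)" if "b \<in> A" for a b
    using that assms by (auto simp: l_def node_def poly_prod)
  have degree_l: "degree (l a) < card A" if "a \<in> A" for a
  proof -
    have "degree (node a) = card A - 1"
      using that assms unfolding node_def by (subst degree_prod_eq_sum_degree) auto
    moreover have "0 < card A"
      using that assms by (auto simp: card_gt_0_iff)
    ultimately show ?thesis
      by (auto simp: l_def)
  qed
  have "f = (\<Sum>a\<in>A. smult (poly f a) (l a))" if f: "degree f < card A" for f
  proof (rule poly_eqI_degree[of A])
    show "poly f b = poly (\<Sum>a\<in>A. smult (poly f a) (l a)) b" if "b \<in> A" for b
      using that assms by (simp add: poly_sum l_values if_distrib cong: if_cong)
    show "degree (\<Sum>a\<in>A. smult (poly f a) (l a)) < card A"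
      using degree_l f by (intro degree_sum_less) auto
  qed (rule f)
  then show ?thesis by blast
qed

lemma prod_roots_dvd:
  fixes p :: "'a :: idom poly"
  assumes "finite A" and "\<And>a. a \<in> A \<Longrightarrow> poly p a = 0"
  shows "(\<Prod>a\<in>A. [:-a, 1:]) dvd p"
  using assms
proof (induction A rule: finite_induct)
  case (insert a A)
  then obtain q where q: "p = (\<Prod>a\<in>A. [:-a, 1:]) * q"
    by auto
  have "poly (\<Prod>a\<in>A. [:-a, 1:]) a \<noteq> 0"
    using insert.hyps by (auto simp: poly_prod)
  moreover have "poly p a = 0"
    using insert.prems by simp
  ultimately have "[:-a, 1:] dvd q"
    by (simp add: q poly_eq_0_iff_dvd[symmetric])
  then have "[:-a, 1:] * (\<Prod>a\<in>A. [:-a, 1:]) dvd q * (\<Prod>a\<in>A. [:-a, 1:])"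
    by (rule mult_dvd_mono) simp
  then show ?case
    using insert.hyps by (simp add: q mult.commute)
qed simp

lemma poly_no_root_constant_sign:
  fixes p :: "real poly"
  assumes no_root: "\<And>t. a < t \<Longrightarrow> t < b \<Longrightarrow> poly p t \<noteq> 0"
  obtains "\<And>t. t \<in> {a..b} \<Longrightarrow> 0 \<le> poly p t" | "\<And>t. t \<in> {a..b} \<Longrightarrow> poly p t \<le> 0"
proof (rule ccontr)
  assume "\<not> thesis"
  then have "\<not> (\<forall>t\<in>{a..b}. 0 \<le> poly p t)" and "\<not> (\<forall>t\<in>{a..b}. poly p t \<le> 0)"
    using that by blast+
  then obtain s t where s: "s \<in> {a..b}" "poly p s < 0" and t: "t \<in> {a..b}" "0 < poly p t"
    by (auto simp: not_le)
  then have "s \<noteq> t" by auto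
  then consider "s < t" | "t < s" by linarith
  then show False
  proof cases
    case 1
    from poly_IVT_pos[OF this s(2) t(2)] s(1) t(1) no_root show False by fastforce
  next
    case 2
    from poly_IVT_neg[OF this t(2) s(2)] s(1) t(1) no_root show False by fastforce
  qed
qed

locale positive_poly_functional =
  fixes L :: "real poly \<Rightarrow> real" and a b :: real
  assumes L_add: "L (p + q) = L p + L q"
    and L_smult: "L (smult c p) = c * L p"
    and L_pos: "p \<noteq> 0 \<Longrightarrow> (\<And>t. t \<in> {a..b} \<Longrightarrow> 0 \<le> poly p t) \<Longrightarrow> 0 < L p"
begin

lemma L_0: "L 0 = 0"
  using L_smult[of 0 0] by simp

lemma L_diff: "L (p - q) = L p - L q"
  using L_add[of "p - q" q] by simp

lemma L_sum: "L (\<Sum>i\<in>I. f i) = (\<Sum>i\<in>I. L (f i))"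
  by (induction I rule: infinite_finite_induct) (auto simp: L_0 L_add)

lemma L_square_pos: "p \<noteq> 0 \<Longrightarrow> 0 < L (p * p)"
  by (rule L_pos) auto

lemma L_nonzero_if_constant_sign:
  assumes "p \<noteq> 0" and "\<And>t. a < t \<Longrightarrow> t < b \<Longrightarrow> poly q t \<noteq> 0" and "q \<noteq> 0"
  shows "L (p * p * q) \<noteq> 0"
  using assms(2)
proof (rule poly_no_root_constant_sign)
  assume "\<And>t. t \<in> {a..b} \<Longrightarrow> 0 \<le> poly q t"
  then have "0 < L (p * p * q)"
    using assms by (intro L_pos) auto
  then show ?thesis by simp
next
  assume "\<And>t. t \<in> {a..b} \<Longrightarrow> poly q t \<le> 0"
  then have "0 < L (smult (- 1) (p * p * q))"
    using assms by (intro L_pos) (auto simp: mult_nonneg_nonpos)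
  then show ?thesis
    unfolding L_smult by simp
qed

fun orth_poly :: "nat \<Rightarrow> real poly" where
  "orth_poly k = monom 1 k -
     (\<Sum>j<k. smult (L (monom 1 k * orth_poly j) / L (orth_poly j * orth_poly j)) (orth_poly j))"

declare orth_poly.simps [simp del]

lemma degree_orth_poly: "degree (orth_poly k) = k"
  and coeff_orth_poly: "coeff (orth_poly k) k = 1"
proof (induction k rule: less_induct)
  case (less k)
  have lower: "coeff (orth_poly j) i = 0" if "j < k" "k \<le> i" for i j
    using that less.IH(1)[of j] by (simp add: coeff_eq_0)
  show lead: "coeff (orth_poly k) k = 1"
    by (subst orth_poly.simps) (simp add: coeff_sum lower)
  have "degree (orth_poly k) \<le> k"
    by (rule degree_le, subst orth_poly.simps) (simp add: coeff_sum lower)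
  moreover have "k \<le> degree (orth_poly k)"
    using lead by (intro le_degree) simp
  ultimately show "degree (orth_poly k) = k"
    by simp
qed

lemma orth_poly_nonzero: "orth_poly k \<noteq> 0"
  using coeff_orth_poly[of k] by auto

lemma orth_poly_orthogonal_pair: "j < k \<Longrightarrow> L (orth_poly k * orth_poly j) = 0"
proof (induction k arbitrary: j rule: less_induct)
  case (less k)
  let ?c = "\<lambda>i. L (monom 1 k * orth_poly i) / L (orth_poly i * orth_poly i)"
  have "L (orth_poly i * orth_poly j) = 0" if "i < k" "i \<noteq> j" for i
    using that less.IH[of i j] less.IH[of j i] less.prems
    by (cases "i < j") (auto simp: mult.commute)
  then have "(\<Sum>i<k. ?c i * L (orth_poly i * orth_poly j)) =
      (\<Sum>i\<in>{j}. ?c i * L (orth_poly i * orth_poly j))"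
    using less.prems by (intro sum.mono_neutral_right) auto
  also have "\<dots> = L (monom 1 k * orth_poly j)"
    using L_square_pos[OF orth_poly_nonzero[of j]] by simp
  finally show ?case
    by (subst orth_poly.simps) (simp add: left_diff_distrib sum_distrib_right L_diff L_sum L_smult)
qed

lemma orth_poly_orthogonal:
  assumes "degree q < k"
  shows "L (orth_poly k * q) = 0"
proof -
  have orth: "L (orth_poly k * q) = 0" if "d \<le> k" "\<And>i. d \<le> i \<Longrightarrow> coeff q i = 0" for d q
    using that
  proof (induction d arbitrary: q)
    case 0
    then have "q = 0" by (simp add: poly_eq_iff)
    then show ?case by (simp add: L_0)
  next
    case (Suc d)
    define r where "r = q - smult (coeff q d) (orth_poly d)"
    have "coeff r i = 0" if "d \<le> i" for i
      using that Suc.prems(2)[of i] coeff_orth_poly[of d] degree_orth_poly[of d]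
      by (cases "i = d") (simp_all add: r_def coeff_eq_0)
    then have "L (orth_poly k * r) = 0"
      using Suc.prems by (intro Suc.IH) auto
    moreover have "L (orth_poly k * q) = L (orth_poly k * r) + coeff q d * L (orth_poly k * orth_poly d)"
      by (simp add: r_def algebra_simps L_diff L_smult)
    ultimately show ?case
      using orth_poly_orthogonal_pair[of d k] Suc.prems(1) by simp
  qed
  show ?thesis
    using assms by (intro orth[of k]) (auto simp: coeff_eq_0)
qed

lemma orth_poly_square_free_roots: "\<not> [:-t, 1:]\<^sup>2 dvd orth_poly m"
proof
  assume "[:-t, 1:]\<^sup>2 dvd orth_poly m"
  then obtain q where q: "orth_poly m = [:-t, 1:] * [:-t, 1:] * q"
    by (auto simp: power2_eq_square)
  then have "q \<noteq> 0"
    using orth_poly_nonzero[of m] by auto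
  then have "degree (orth_poly m) = 2 + degree q"
    unfolding q by (simp add: degree_mult_eq del: mult_pCons_left)
  then have "L (orth_poly m * q) = 0"
    by (intro orth_poly_orthogonal) (simp add: degree_orth_poly)
  moreover have "orth_poly m * q = [:-t, 1:] * q * ([:-t, 1:] * q)"
    unfolding q by (simp only: mult_ac)
  ultimately show False
    using L_square_pos[of "[:-t, 1:] * q"] \<open>q \<noteq> 0\<close> by (simp del: mult_pCons_left)
qed

lemma card_orth_poly_roots: "card {t \<in> {a<..<b}. poly (orth_poly m) t = 0} = m"
proof -
  define A where "A = {t \<in> {a<..<b}. poly (orth_poly m) t = 0}"
  define P where "P = (\<Prod>t\<in>A. [:-t, 1:])"
  have fin: "finite A"
    using poly_roots_finite[OF orth_poly_nonzero[of m]]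
    by (rule finite_subset[rotated]) (auto simp: A_def)
  have P: "P \<noteq> 0"
    using fin by (simp add: P_def)
  have degree_P: "degree P = card A"
    unfolding P_def by (subst degree_prod_eq_sum_degree) auto
  obtain q where q: "orth_poly m = P * q"
    using prod_roots_dvd[OF fin, of "orth_poly m"] by (auto simp: A_def P_def)
  have "poly q t \<noteq> 0" if t: "a < t" "t < b" for t
  proof
    assume root: "poly q t = 0"
    then have "t \<in> A"
      using t by (simp add: A_def q)
    then have "[:-t, 1:] dvd P"
      unfolding P_def using fin by (intro dvd_prodI)
    moreover have "[:-t, 1:] dvd q"
      using root by (simp add: poly_eq_0_iff_dvd)
    ultimately show False
      using orth_poly_square_free_roots[of t m] mult_dvd_mono[of "[:-t, 1:]" P "[:-t, 1:]" q]
      by (simp add: q power2_eq_square)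
  qed
  then have "L (P * P * q) \<noteq> 0"
    using P orth_poly_nonzero[of m] by (intro L_nonzero_if_constant_sign) (auto simp: q)
  moreover have "orth_poly m * P = P * P * q"
    by (simp add: q)
  ultimately have "m \<le> card A"
    using orth_poly_orthogonal[of P m] degree_P by (metis not_le)
  moreover have "degree P \<le> degree (orth_poly m)"
    using orth_poly_nonzero[of m] by (intro dvd_imp_degree_le) (auto simp: q)
  ultimately show ?thesis
    using degree_P by (simp add: degree_orth_poly A_def)
qed

lemma interpolatory_quadrature:
  assumes "finite A"
  shows "\<exists>W. \<forall>f. degree f < card A \<longrightarrow> L f = (\<Sum>t\<in>A. W t * poly f t)"
proof -
  obtain l where l: "\<And>f. degree f < card A \<Longrightarrow> f = (\<Sum>t\<in>A. smult (poly f t) (l t))"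
    using lagrange_interpolation[OF assms] by blast
  have "L f = (\<Sum>t\<in>A. L (l t) * poly f t)" if "degree f < card A" for f
    by (subst l[OF that]) (simp add: L_sum L_smult mult.commute)
  then show ?thesis
    by (intro exI[of _ "\<lambda>t. L (l t)"]) blast
qed

lemma positive_poly_functional_weighted:
  assumes "w \<noteq> 0" and "\<And>t. t \<in> {a..b} \<Longrightarrow> 0 \<le> poly w t"
  shows "positive_poly_functional (\<lambda>f. L (w * f)) a b"
proof
  show "L (w * (p + q)) = L (w * p) + L (w * q)" for p q
    by (simp add: distrib_left L_add)
  show "L (w * smult c p) = c * L (w * p)" for c p
    by (simp add: L_smult)
  show "0 < L (w * p)" if "p \<noteq> 0" "\<And>t. t \<in> {a..b} \<Longrightarrow> 0 \<le> poly p t" for p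
    using assms that by (intro L_pos) auto
qed

lemma orthogonal_nodes_exactness:
  assumes p: "p \<noteq> 0" "\<And>t. t \<in> A \<Longrightarrow> poly p t = 0"
    and orth: "\<And>q. degree q < m \<Longrightarrow> L (p * q) = 0"
    and exact: "\<And>f. degree f < degree p \<Longrightarrow> L f = (\<Sum>t\<in>A. W t * poly f t)"
    and f: "degree f < degree p + m"
  shows "L f = (\<Sum>t\<in>A. W t * poly f t)"
proof -
  define q where "q = f div p"
  define r where "r = f mod p"
  have f_eq: "f = p * q + r"
    by (simp add: q_def r_def)
  have degree_r: "r = 0 \<or> degree r < degree p"
    using degree_mod_less[OF p(1), of f] by (simp add: r_def)
  have "L (p * q) = 0"
  proof (cases "q = 0")
    case False
    then have "degree (p * q) = degree p + degree q"
      using p(1) by (simp add: degree_mult_eq)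
    moreover have "degree (p * q) \<le> max (degree f) (degree r)"
      using degree_diff_le_max[of f r] by (simp add: f_eq)
    ultimately have "degree q < m"
      using f degree_r by auto
    then show ?thesis
      by (rule orth)
  qed (simp add: L_0)
  moreover have "L r = (\<Sum>t\<in>A. W t * poly r t)"
    using degree_r exact by (auto simp: L_0)
  moreover have "poly f t = poly r t" if "t \<in> A" for t
    using p(2)[OF that] by (simp add: f_eq)
  ultimately show ?thesis
    by (simp add: f_eq L_add p(2))
qed

lemma gauss_quadrature_prescribed_nodes:
  assumes w: "w \<noteq> 0" "\<And>t. t \<in> {a..b} \<Longrightarrow> 0 \<le> poly w t"
    and E: "finite E" "\<And>t. t \<in> E \<Longrightarrow> poly w t = 0" "card E = degree w" "E \<inter> {a<..<b} = {}"
  shows "\<exists>A W. finite A \<and> A \<subseteq> {a<..<b} \<and> card A = m \<and>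
    (\<forall>f. degree f < degree w + 2 * m \<longrightarrow> L f = (\<Sum>t\<in>A \<union> E. W t * poly f t))"
proof -
  interpret weighted: positive_poly_functional "\<lambda>f. L (w * f)" a b
    using w by (rule positive_poly_functional_weighted)
  define p where "p = weighted.orth_poly m"
  define A where "A = {t \<in> {a<..<b}. poly p t = 0}"
  have p: "p \<noteq> 0" "degree p = m"
    by (simp_all add: p_def weighted.orth_poly_nonzero weighted.degree_orth_poly)
  have A: "finite A" "A \<subseteq> {a<..<b}" "card A = m"
    using poly_roots_finite[OF p(1)] weighted.card_orth_poly_roots[of m]
    by (auto simp: A_def p_def)
  have degree_wp: "degree (w * p) = degree w + m"
    using w(1) p by (simp add: degree_mult_eq)
  have "card (A \<union> E) = degree (w * p)"
    using A E unfolding degree_wp by (subst card_Un_disjoint) auto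
  then obtain W where W: "\<And>f. degree f < degree (w * p) \<Longrightarrow> L f = (\<Sum>t\<in>A \<union> E. W t * poly f t)"
    using interpolatory_quadrature[of "A \<union> E"] A(1) E(1) by auto
  have "L f = (\<Sum>t\<in>A \<union> E. W t * poly f t)" if "degree f < degree w + 2 * m" for f
  proof (rule orthogonal_nodes_exactness[OF _ _ _ W])
    show "w * p \<noteq> 0"
      using w(1) p(1) by simp
    show "poly (w * p) t = 0" if "t \<in> A \<union> E" for t
      using that E(2) by (auto simp: A_def)
    show "L (w * p * q) = 0" if "degree q < m" for q
      using weighted.orth_poly_orthogonal[OF that] by (simp add: p_def mult.assoc)
    show "degree f < degree (w * p) + m"
      using that degree_wp by simp
  qed
  then show ?thesis
    using A by blast
qed

lemma gauss_radau_quadrature: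
  "\<exists>A W. finite A \<and> A \<subseteq> {a<..<b} \<and> card A = m \<and>
    (\<forall>f. degree f \<le> 2 * m \<longrightarrow> L f = (\<Sum>t\<in>A \<union> {a}. W t * poly f t))"
proof -
  have "\<exists>A W. finite A \<and> A \<subseteq> {a<..<b} \<and> card A = m \<and>
    (\<forall>f. degree f < degree [:-a, 1:] + 2 * m \<longrightarrow> L f = (\<Sum>t\<in>A \<union> {a}. W t * poly f t))"
    by (rule gauss_quadrature_prescribed_nodes) auto
  then show ?thesis
    by (simp add: less_Suc_eq_le)
qed

lemma gauss_lobatto_quadrature:
  assumes "a < b"
  shows "\<exists>A W. finite A \<and> A \<subseteq> {a<..<b} \<and> card A = m \<and>
    (\<forall>f. degree f \<le> 2 * m + 1 \<longrightarrow> L f = (\<Sum>t\<in>A \<union> {a, b}. W t * poly f t))"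
proof -
  have "\<exists>A W. finite A \<and> A \<subseteq> {a<..<b} \<and> card A = m \<and>
    (\<forall>f. degree f < degree ([:-a, 1:] * [:b, -1:]) + 2 * m \<longrightarrow> L f = (\<Sum>t\<in>A \<union> {a, b}. W t * poly f t))"
  proof (rule gauss_quadrature_prescribed_nodes)
    show "0 \<le> poly ([:-a, 1:] * [:b, -1:]) t" if "t \<in> {a..b}" for t
    proof -
      have "0 \<le> (t - a) * (b - t)"
        using that by simp
      then show ?thesis
        by (simp add: algebra_simps)
    qed
  qed (use assms in auto)
  moreover have "degree ([:-a, 1:] * [:b, -1:]) = 2"
    by (subst degree_mult_eq) auto
  ultimately show ?thesis
    by (simp add: less_Suc_eq_le)
qed

end

section \<open>Averaging over a finite subgroup of the torus\<close>

lemma cmod_root_of_unity: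
  assumes "z ^ N = 1" and "0 < N"
  shows "cmod z = 1"
  using power_eq_imp_eq_norm[of z N 1] assms by simp

lemma power_int_root_of_unity:
  fixes z :: complex
  assumes "z ^ N = 1" and "0 < N"
  shows "z powi k = z ^ nat (k mod int N)"
proof -
  have "z \<noteq> 0"
    using assms by (auto simp: power_0_left)
  have "k = int N * (k div int N) + int (nat (k mod int N))"
    using assms(2) by simp
  then have "z powi k = (z powi int N) powi (k div int N) * z powi int (nat (k mod int N))"
    using \<open>z \<noteq> 0\<close> by (metis power_int_add power_int_mult)
  then show ?thesis
    by (simp only: power_int_of_nat assms(1) power_int_1_left mult_1_left)
qed

lemma sum_roots_of_unity_power:
  assumes "0 < m" "m < N"
  shows "(\<Sum>z :: complex | z ^ N = 1. z ^ m) = 0"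
proof -
  have "card {z :: complex. z ^ m = 1} < card {z :: complex. z ^ N = 1}"
    using assms by (simp add: card_roots_unity_eq)
  then have "\<not> {z :: complex. z ^ N = 1} \<subseteq> {z. z ^ m = 1}"
    using card_mono[OF finite_roots_unity[of m], of "{z :: complex. z ^ N = 1}"] assms(1) by auto
  then obtain u :: complex where u: "u ^ N = 1" "u ^ m \<noteq> 1"
    by blast
  then have "u \<noteq> 0"
    using assms by (auto simp: power_0_left)
  have "(\<Sum>z | z ^ N = 1. z ^ m) = (\<Sum>z | z ^ N = 1. (u * z) ^ m)"
    using u(1) \<open>u \<noteq> 0\<close>
    by (intro sum.reindex_bij_witness[of _ "\<lambda>z. u * z" "\<lambda>z. z / u"])
       (auto simp: power_mult_distrib power_divide)
  also have "\<dots> = u ^ m * (\<Sum>z | z ^ N = 1. z ^ m)"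
    by (simp add: power_mult_distrib sum_distrib_left)
  finally show ?thesis
    using u(2) by simp
qed

lemma sum_roots_of_unity_power_int:
  assumes N: "0 < N"
  shows "(\<Sum>z | z ^ N = 1. z powi k) = (if int N dvd k then of_nat N else 0 :: complex)"
proof -
  define m where "m = nat (k mod int N)"
  have sum_eq: "(\<Sum>z | z ^ N = 1. z powi k) = (\<Sum>z :: complex | z ^ N = 1. z ^ m)"
    by (intro sum.cong refl) (simp add: power_int_root_of_unity[OF _ N] m_def)
  show ?thesis
  proof (cases "int N dvd k")
    case True
    then have "m = 0"
      by (simp add: m_def)
    then show ?thesis
      using True N by (simp add: sum_eq card_roots_unity_eq)
  next
    case False
    then have "0 < m" "m < N"
      using N pos_mod_sign[of "int N" k] pos_mod_bound[of "int N" k]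
      unfolding m_def dvd_eq_mod_eq_0 by linarith+
    then show ?thesis
      using False by (simp add: sum_eq sum_roots_of_unity_power)
  qed
qed

definition torus_group :: "nat \<Rightarrow> (complex \<times> complex) set" where
  "torus_group r = {(u, v). u ^ (2 * r) = 1 \<and> v ^ r = u ^ r}"

lemma torus_group_roots:
  assumes "(u, v) \<in> torus_group r"
  shows "u ^ (2 * r) = 1" "v ^ (2 * r) = 1"
proof -
  show "u ^ (2 * r) = 1"
    using assms by (simp add: torus_group_def)
  moreover have "v ^ (2 * r) = u ^ (2 * r)"
    using assms by (simp add: torus_group_def mult.commute[of 2] power_mult)
  ultimately show "v ^ (2 * r) = 1" by simp
qed

lemma torus_group_norms:
  assumes "0 < r" and "(u, v) \<in> torus_group r"
  shows "cmod u = 1" "cmod v = 1"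
  using torus_group_roots[OF assms(2)] assms(1) by (auto intro: cmod_root_of_unity[of _ "2 * r"])

lemma torus_group_diagonal: "u ^ (2 * r) = 1 \<Longrightarrow> (u, u) \<in> torus_group r"
  by (simp add: torus_group_def)

lemma proj_torus_group:
  assumes "proj = fst \<or> proj = snd"
  shows "proj ` torus_group r = {u. u ^ (2 * r) = 1}"
proof (intro equalityI subsetI)
  fix u :: complex assume "u \<in> {u. u ^ (2 * r) = 1}"
  then have "(u, u) \<in> torus_group r"
    by (simp add: torus_group_diagonal)
  moreover have "proj (u, u) = u"
    using assms by auto
  ultimately show "u \<in> proj ` torus_group r"
    by (metis imageI)
qed (use assms in \<open>auto dest: torus_group_roots\<close>)

lemma finite_torus_group:
  assumes "0 < r"
  shows "finite (torus_group r)"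
proof (rule finite_subset)
  show "torus_group r \<subseteq> fst ` torus_group r \<times> snd ` torus_group r"
    by force
  show "finite (fst ` torus_group r \<times> snd ` torus_group r)"
    using assms unfolding proj_torus_group[of fst, simplified] proj_torus_group[of snd, simplified]
    by (intro finite_cartesian_product finite_roots_unity) simp_all
qed

lemma sum_torus_group:
  assumes "0 < r"
  shows "(\<Sum>(u, v)\<in>torus_group r. f u v) = (\<Sum>u | u ^ (2 * r) = 1. \<Sum>z | z ^ r = 1. f u (u * z))"
proof -
  have nonzero: "u \<noteq> 0" if "u ^ (2 * r) = 1" for u :: complex
    using that assms by (auto simp: power_0_left)
  have "(\<Sum>(u, v)\<in>torus_group r. f u v) =
      (\<Sum>(u, z)\<in>{u. u ^ (2 * r) = 1} \<times> {z. z ^ r = 1}. f u (u * z))"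
    by (rule sum.reindex_bij_witness[of _ "\<lambda>(u, z). (u, u * z)" "\<lambda>(u, v). (u, v / u)"])
       (auto simp: torus_group_def nonzero power_mult_distrib power_divide)
  then show ?thesis
    by (simp add: sum.cartesian_product)
qed

lemma card_torus_group:
  assumes "0 < r"
  shows "card (torus_group r) = 2 * r\<^sup>2"
  using sum_torus_group[OF assms, of "\<lambda>_ _. 1 :: nat"] assms
  by (simp add: card_roots_unity_eq power2_eq_square case_prod_unfold)

lemma sum_torus_group_character:
  assumes r: "0 < r" and kl: "\<bar>k\<bar> + \<bar>l\<bar> < 2 * int r"
  shows "(\<Sum>(u, v)\<in>torus_group r. u powi k * v powi l) = (if k = 0 \<and> l = 0 then of_nat (2 * r\<^sup>2) else 0)"
proof -
  have split: "u powi k * (u * z) powi l = u powi (k + l) * z powi l"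
    if "u ^ (2 * r) = 1" for u z :: complex
  proof -
    have "u \<noteq> 0"
      using that r by (auto simp: power_0_left)
    then show ?thesis
      by (simp add: power_int_add power_int_mult_distrib)
  qed
  have "(\<Sum>(u, v)\<in>torus_group r. u powi k * v powi l) =
      (\<Sum>u | u ^ (2 * r) = 1. \<Sum>z | z ^ r = 1. u powi (k + l) * z powi l)"
    unfolding sum_torus_group[OF r] by (intro sum.cong refl) (simp add: split)
  also have "\<dots> = (\<Sum>u | u ^ (2 * r) = 1. u powi (k + l)) * (\<Sum>z | z ^ r = 1. z powi l)"
    by (simp add: sum_product)
  also have "\<dots> = (if int (2 * r) dvd k + l then of_nat (2 * r) else 0) *
      (if int r dvd l then of_nat r else 0)"
    using r
    by (simp only: sum_roots_of_unity_power_int zero_less_mult_iff zero_less_numeral simp_thms)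
  also have "\<dots> = (if k = 0 \<and> l = 0 then of_nat (2 * r\<^sup>2) else 0)"
  proof -
    have "k = 0 \<and> l = 0" if "int (2 * r) dvd k + l" "int r dvd l"
    proof -
      have "k + l = 0"
        using that(1) kl dvd_imp_le_int[of "k + l" "int (2 * r)"] by linarith
      moreover from this have "l = 0"
        using that(2) kl dvd_imp_le_int[of l "int r"] by linarith
      ultimately show ?thesis by simp
    qed
    then show ?thesis
      by (auto simp: power2_eq_square)
  qed
  finally show ?thesis .
qed

lemma unit_complex_Re_Im:
  assumes "cmod z = 1"
  shows "of_real (Re z) = 1 / 2 * (inverse z * (1 + z\<^sup>2))"
    and "of_real (Im z) = - \<i> / 2 * (inverse z * (- 1 + z\<^sup>2))"
proof -
  have "z \<noteq> 0" and inverse: "inverse z = cnj z"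
    using assms by (auto simp: cmod_def complex_eq_iff)
  have "inverse z * (1 + z\<^sup>2) = inverse z + z" "inverse z * (- 1 + z\<^sup>2) = z - inverse z"
    using \<open>z \<noteq> 0\<close> by (simp_all add: field_simps power2_eq_square)
  then show "of_real (Re z) = 1 / 2 * (inverse z * (1 + z\<^sup>2))"
    and "of_real (Im z) = - \<i> / 2 * (inverse z * (- 1 + z\<^sup>2))"
    by (simp_all add: inverse complex_eq_iff)
qed

lemma Re_Im_monomial_character_expansion:
  "\<exists>c. \<forall>z. cmod z = 1 \<longrightarrow>
    of_real (Re z ^ a * Im z ^ b) = (\<Sum>j\<le>a + b. c j * z powi (2 * int j - int (a + b)))"
proof -
  define p :: "complex poly"
    where "p = smult ((1 / 2) ^ a * (- \<i> / 2) ^ b) ([:1, 1:] ^ a * [:-1, 1:] ^ b)"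
  have poly_p_eq: "poly p y = (1 / 2) ^ a * (- \<i> / 2) ^ b * ((1 + y) ^ a * (- 1 + y) ^ b)" for y
    by (simp add: p_def)
  have "degree ([:1, 1 :: complex:] ^ a * [:-1, 1:] ^ b) \<le> a + b"
    by (rule order_trans[OF degree_mult_le]) (simp add: degree_power_eq)
  then have "degree p \<le> a + b"
    unfolding p_def by (rule order_trans[OF degree_smult_le])
  then have poly_p_sum: "poly p y = (\<Sum>j\<le>a + b. coeff p j * y ^ j)" for y
    unfolding poly_altdef by (intro sum.mono_neutral_left) (auto simp: coeff_eq_0)
  have "of_real (Re z ^ a * Im z ^ b) = (\<Sum>j\<le>a + b. coeff p j * z powi (2 * int j - int (a + b)))"
    if z: "cmod z = 1" for z
  proof -
    have "z \<noteq> 0"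
      using z by auto
    then have "z powi (int (2 * j) - int (a + b)) = (z\<^sup>2) ^ j / z ^ (a + b)" for j
      by (simp only: power_int_diff power_int_of_nat power_mult simp_thms)
    then have shift: "inverse z ^ (a + b) * (z\<^sup>2) ^ j = z powi (2 * int j - int (a + b))" for j
      by (simp add: power_inverse divide_inverse mult.commute)
    have "of_real (Re z ^ a * Im z ^ b) = inverse z ^ (a + b) * poly p (z\<^sup>2)"
      by (simp only: of_real_mult of_real_power unit_complex_Re_Im[OF z] poly_p_eq
          power_mult_distrib power_add mult_ac)
    also have "\<dots> = (\<Sum>j\<le>a + b. coeff p j * (inverse z ^ (a + b) * (z\<^sup>2) ^ j))"
      by (simp only: poly_p_sum sum_distrib_left mult.left_commute)
    finally show ?thesis
      by (simp only: shift)
  qed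
  then show ?thesis by blast
qed

lemma sum_atMost_double_eq:
  fixes p :: nat
  shows "(\<Sum>j\<le>p. if 2 * j = p then f j else 0) =
    (if even p then f (p div 2) else (0 :: 'a :: comm_monoid_add))"
proof (cases "even p")
  case True
  then have "2 * j = p \<longleftrightarrow> j = p div 2" for j
    by auto
  then show ?thesis
    using True by simp
next
  case False
  then show ?thesis
    by (auto intro!: sum.neutral)
qed

lemma sum_torus_group_laurent:
  fixes \<gamma> \<delta> :: "nat \<Rightarrow> complex"
  assumes r: "0 < r" and pq: "p + q < 2 * r"
  shows "(\<Sum>(u, v)\<in>torus_group r. (\<Sum>j\<le>p. \<gamma> j * (u * z) powi (2 * int j - int p)) *
      (\<Sum>l\<le>q. \<delta> l * (v * w) powi (2 * int l - int q))) =
    (if even p \<and> even q then of_nat (2 * r\<^sup>2) * (\<gamma> (p div 2) * \<delta> (q div 2)) else 0)"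
    (is "?lhs = ?rhs")
proof -
  define k where "k j = 2 * int j - int p" for j
  define k' where "k' l = 2 * int l - int q" for l
  define c where "c j l = \<gamma> j * \<delta> l * (z powi k j * w powi k' l)" for j l
  have "?lhs = (\<Sum>(u, v)\<in>torus_group r. \<Sum>j\<le>p. \<Sum>l\<le>q. c j l * (u powi k j * v powi k' l))"
    unfolding sum_product by (simp only: power_int_mult_distrib c_def k_def k'_def mult_ac)
  also have "\<dots> = (\<Sum>j\<le>p. \<Sum>l\<le>q. \<Sum>(u, v)\<in>torus_group r. c j l * (u powi k j * v powi k' l))"
    unfolding case_prod_unfold by (subst sum.swap) (intro sum.cong refl sum.swap)
  also have "\<dots> = (\<Sum>j\<le>p. \<Sum>l\<le>q.
      of_nat (2 * r\<^sup>2) * ((if 2 * j = p then \<gamma> j else 0) * (if 2 * l = q then \<delta> l else 0)))"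
  proof (intro sum.cong refl)
    fix j l assume "j \<in> {..p}" "l \<in> {..q}"
    then have "\<bar>k j\<bar> + \<bar>k' l\<bar> < 2 * int r"
      using pq by (auto simp: k_def k'_def)
    then have "(\<Sum>(u, v)\<in>torus_group r. c j l * (u powi k j * v powi k' l)) =
        c j l * (if k j = 0 \<and> k' l = 0 then of_nat (2 * r\<^sup>2) else 0)"
      using sum_torus_group_character[OF r]
      by (simp only: case_prod_unfold flip: sum_distrib_left)
    moreover have "k j = 0 \<longleftrightarrow> 2 * j = p" "k' l = 0 \<longleftrightarrow> 2 * l = q"
      by (auto simp: k_def k'_def)
    moreover have "c j l = \<gamma> j * \<delta> l" if "k j = 0" "k' l = 0"
      using that by (simp add: c_def)
    ultimately show "(\<Sum>(u, v)\<in>torus_group r. c j l * (u powi k j * v powi k' l)) =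
        of_nat (2 * r\<^sup>2) * ((if 2 * j = p then \<gamma> j else 0) * (if 2 * l = q then \<delta> l else 0))"
      by simp
  qed
  also have "\<dots> = of_nat (2 * r\<^sup>2) *
      ((\<Sum>j\<le>p. if 2 * j = p then \<gamma> j else 0) * (\<Sum>l\<le>q. if 2 * l = q then \<delta> l else 0))"
    unfolding sum_product by (simp only: sum_distrib_left)
  also have "\<dots> = ?rhs"
    unfolding sum_atMost_double_eq by simp
  finally show ?thesis .
qed

lemma sum_torus_group_Re_Im_monomial:
  assumes r: "0 < r" and deg: "a + b + (c + d) < 2 * r"
  shows "\<exists>K. (odd (a + b) \<or> odd (c + d) \<longrightarrow> K = 0) \<and> (\<forall>z w. cmod z = 1 \<longrightarrow> cmod w = 1 \<longrightarrow>
    (\<Sum>(u, v)\<in>torus_group r. Re (u * z) ^ a * Im (u * z) ^ b * (Re (v * w) ^ c * Im (v * w) ^ d)) = K)"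
proof -
  define p q where "p = a + b" and "q = c + d"
  obtain \<gamma> where \<gamma>: "\<And>z. cmod z = 1 \<Longrightarrow>
      of_real (Re z ^ a * Im z ^ b) = (\<Sum>j\<le>p. \<gamma> j * z powi (2 * int j - int p))"
    using Re_Im_monomial_character_expansion unfolding p_def by blast
  obtain \<delta> where \<delta>: "\<And>z. cmod z = 1 \<Longrightarrow>
      of_real (Re z ^ c * Im z ^ d) = (\<Sum>l\<le>q. \<delta> l * z powi (2 * int l - int q))"
    using Re_Im_monomial_character_expansion unfolding q_def by blast
  define K where "K = (if even p \<and> even q then of_nat (2 * r\<^sup>2) * (\<gamma> (p div 2) * \<delta> (q div 2)) else 0)"
  have "(\<Sum>(u, v)\<in>torus_group r.
      Re (u * z) ^ a * Im (u * z) ^ b * (Re (v * w) ^ c * Im (v * w) ^ d)) = Re K"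
    if zw: "cmod z = 1" "cmod w = 1" for z w
  proof -
    have expand: "complex_of_real
        (Re (u * z) ^ a * Im (u * z) ^ b * (Re (v * w) ^ c * Im (v * w) ^ d)) =
        (\<Sum>j\<le>p. \<gamma> j * (u * z) powi (2 * int j - int p)) *
        (\<Sum>l\<le>q. \<delta> l * (v * w) powi (2 * int l - int q))" if "(u, v) \<in> torus_group r" for u v
    proof -
      have "cmod (u * z) = 1" "cmod (v * w) = 1"
        using torus_group_norms[OF r that] zw by (simp_all add: norm_mult)
      then show ?thesis
        by (simp only: of_real_mult[of "_ * _" "_ * _"] \<gamma> \<delta>)
    qed
    have "complex_of_real (\<Sum>(u, v)\<in>torus_group r.
        Re (u * z) ^ a * Im (u * z) ^ b * (Re (v * w) ^ c * Im (v * w) ^ d)) =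
      (\<Sum>(u, v)\<in>torus_group r.
        (\<Sum>j\<le>p. \<gamma> j * (u * z) powi (2 * int j - int p)) *
        (\<Sum>l\<le>q. \<delta> l * (v * w) powi (2 * int l - int q)))"
      unfolding of_real_sum by (rule sum.cong[OF refl], clarify) (rule expand)
    also have "\<dots> = K"
      unfolding K_def by (rule sum_torus_group_laurent[OF r deg[folded p_def q_def]])
    finally show ?thesis
      by (simp only: complex_eq_iff Re_complex_of_real)
  qed
  moreover have "Re K = 0" if "odd (a + b) \<or> odd (c + d)"
    using that by (auto simp: K_def p_def q_def)
  ultimately show ?thesis by blast
qed

section \<open>The three-dimensional sphere\<close>

lemma sum_atMost_3: "(\<Sum>i\<le>(3::nat). f i) = f 0 + f 1 + f 2 + f 3"
  by (simp add: numeral_3_eq_3 numeral_2_eq_2)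

lemma prod_atMost_3: "(\<Prod>i\<le>(3::nat). f i) = f 0 * f 1 * f 2 * (f 3 :: 'a :: comm_monoid_mult)"
  by (simp add: numeral_3_eq_3 numeral_2_eq_2)

definition moment_map :: "(nat \<Rightarrow> real) \<Rightarrow> real" where
  "moment_map x = (x 0)\<^sup>2 + (x 1)\<^sup>2"

lemma moment_map_measurable [measurable]: "moment_map \<in> borel_measurable (lborel_PiM 3)"
  unfolding moment_map_def[abs_def] by simp

lemma moment_map_compl: "x \<in> unit_sphere 3 \<Longrightarrow> 1 - moment_map x = (x 2)\<^sup>2 + (x 3)\<^sup>2"
  using unit_sphere_sum_squares[of x 3] by (simp add: moment_map_def sum_atMost_3)

lemma moment_map_bounds: "x \<in> unit_sphere 3 \<Longrightarrow> moment_map x \<in> {0..1}"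
  using moment_map_compl[of x] by (simp add: moment_map_def) (smt (verit) zero_le_power2)

definition torus_point :: "real \<Rightarrow> complex \<Rightarrow> complex \<Rightarrow> nat \<Rightarrow> real" where
  "torus_point t z w = (\<lambda>i\<in>{..3}.
     if i = 0 then sqrt t * Re z else if i = 1 then sqrt t * Im z
     else if i = 2 then sqrt (1 - t) * Re w else sqrt (1 - t) * Im w)"

lemma torus_point_nth [simp]:
  "torus_point t z w 0 = sqrt t * Re z" "torus_point t z w (Suc 0) = sqrt t * Im z"
  "torus_point t z w 2 = sqrt (1 - t) * Re w" "torus_point t z w 3 = sqrt (1 - t) * Im w"
  by (simp_all add: torus_point_def)

lemma moment_map_torus_point:
  assumes "0 \<le> t" and "cmod z = 1"
  shows "moment_map (torus_point t z w) = t"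
proof -
  have "moment_map (torus_point t z w) = t * (cmod z)\<^sup>2"
    using assms(1) by (simp add: moment_map_def power_mult_distrib cmod_power2 distrib_left)
  then show ?thesis
    by (simp add: assms(2))
qed

lemma torus_point_in_sphere:
  assumes t: "t \<in> {0..1}" and "cmod z = 1" "cmod w = 1"
  shows "torus_point t z w \<in> unit_sphere 3"
proof -
  have "(\<Sum>i\<le>3. (torus_point t z w i)\<^sup>2) = t * (cmod z)\<^sup>2 + (1 - t) * (cmod w)\<^sup>2"
    using t by (simp add: sum_atMost_3 power_mult_distrib cmod_power2 distrib_left)
  then show ?thesis
    using assms by (simp add: unit_sphere_def eucl_norm_def torus_point_def)
qed

lemma ex_unit_complex_polar: "\<exists>u. cmod u = 1 \<and> z = of_real (cmod z) * u"
  by (intro exI[of _ "cis (Arg z)"]) (simp add: rcis_cmod_Arg flip: rcis_def)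

lemma unit_sphere_3_torus_point:
  assumes x: "x \<in> unit_sphere 3"
  obtains z w where "cmod z = 1" "cmod w = 1" "x = torus_point (moment_map x) z w"
proof -
  obtain z where z: "cmod z = 1" "Complex (x 0) (x 1) = of_real (sqrt (moment_map x)) * z"
    using ex_unit_complex_polar[of "Complex (x 0) (x 1)"] by (auto simp: cmod_def moment_map_def)
  obtain w where w: "cmod w = 1" "Complex (x 2) (x 3) = of_real (sqrt (1 - moment_map x)) * w"
    using ex_unit_complex_polar[of "Complex (x 2) (x 3)"]
    by (auto simp: cmod_def moment_map_compl[OF x])
  have "x i = torus_point (moment_map x) z w i" for i
  proof (cases "i \<le> 3")
    case True
    then consider "i = 0" | "i = 1" | "i = 2" | "i = 3" by linarith
    then show ?thesis
      using z(2) w(2) by cases (simp_all add: complex_eq_iff)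
  next
    case False
    then show ?thesis
      using x by (auto simp: unit_sphere_def torus_point_def PiE_def extensional_def)
  qed
  then show ?thesis
    using that z(1) w(1) by blast
qed

definition torus_rot :: "complex \<Rightarrow> complex \<Rightarrow> (nat \<Rightarrow> real) \<Rightarrow> nat \<Rightarrow> real" where
  "torus_rot u v = rot 0 1 u \<circ> rot 2 3 v"

lemma sphere_symmetry_torus_rot:
  assumes "cmod u = 1" "cmod v = 1"
  shows "sphere_symmetry 3 (torus_rot u v)"
  unfolding torus_rot_def using assms by (intro sphere_symmetry_comp sphere_symmetry_rot) auto

lemma torus_rot_torus_point: "torus_rot u v (torus_point t z w) = torus_point t (u * z) (v * w)"
  by (auto simp: torus_rot_def rot_def torus_point_def fun_eq_iff algebra_simps)

lemma monomial_torus_point: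
  "monomial 3 \<alpha> (torus_point t z w) =
    sqrt t ^ (\<alpha> 0 + \<alpha> 1) * sqrt (1 - t) ^ (\<alpha> 2 + \<alpha> 3) *
    (Re z ^ \<alpha> 0 * Im z ^ \<alpha> 1 * (Re w ^ \<alpha> 2 * Im w ^ \<alpha> 3))"
  by (simp add: prod_atMost_3 power_mult_distrib power_add)

lemma sum_torus_group_monomial:
  assumes r: "0 < r" and \<alpha>: "(\<Sum>i\<le>3. \<alpha> i) < 2 * r"
  shows "\<exists>f. degree f < r \<and> (\<forall>t\<in>{0..1}. \<forall>z w. cmod z = 1 \<longrightarrow> cmod w = 1 \<longrightarrow>
    (\<Sum>(u, v)\<in>torus_group r. monomial 3 \<alpha> (torus_point t (u * z) (v * w))) = poly f t)"
proof -
  define p where "p = \<alpha> 0 + \<alpha> 1"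
  define q where "q = \<alpha> 2 + \<alpha> 3"
  have pq: "p + q < 2 * r"
    using \<alpha> by (simp add: sum_atMost_3 p_def q_def)
  obtain K where K_odd: "odd p \<or> odd q \<Longrightarrow> K = 0"
    and K: "\<And>z w. cmod z = 1 \<Longrightarrow> cmod w = 1 \<Longrightarrow> (\<Sum>(u, v)\<in>torus_group r.
      Re (u * z) ^ \<alpha> 0 * Im (u * z) ^ \<alpha> 1 * (Re (v * w) ^ \<alpha> 2 * Im (v * w) ^ \<alpha> 3)) = K"
    using sum_torus_group_Re_Im_monomial[OF r pq[unfolded p_def q_def]] unfolding p_def q_def by blast
  define f where "f = smult K ([:0, 1:] ^ (p div 2) * [:1, -1:] ^ (q div 2))"
  have "(\<Sum>(u, v)\<in>torus_group r. monomial 3 \<alpha> (torus_point t (u * z) (v * w))) = poly f t"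
    if t: "t \<in> {0..1}" and zw: "cmod z = 1" "cmod w = 1" for t z w
  proof -
    have "(\<Sum>(u, v)\<in>torus_group r. monomial 3 \<alpha> (torus_point t (u * z) (v * w))) =
        sqrt t ^ p * sqrt (1 - t) ^ q * K"
      unfolding monomial_torus_point K[OF zw, symmetric] sum_distrib_left
      by (simp add: p_def q_def case_prod_unfold)
    also have "\<dots> = t ^ (p div 2) * (1 - t) ^ (q div 2) * K"
      using t K_odd by (cases "odd p \<or> odd q") (auto simp: real_sqrt_power_even)
    finally show ?thesis
      by (simp add: f_def poly_power mult.commute)
  qed
  moreover have "degree f < r"
  proof -
    have "degree f \<le> degree ([:0, 1 :: real:] ^ (p div 2)) + degree ([:1, -1 :: real:] ^ (q div 2))"
      unfolding f_def by (rule order_trans[OF degree_smult_le degree_mult_le])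
    also have "\<dots> = p div 2 + q div 2"
      by (simp add: degree_power_eq)
    also have "\<dots> < r"
      using pq by simp
    finally show ?thesis .
  qed
  ultimately show ?thesis by blast
qed

definition moment_functional :: "real poly \<Rightarrow> real" where
  "moment_functional f = (\<integral>x. poly f (moment_map x) \<partial>sphere_measure 3)"

lemma integral_monomial_torus_group:
  assumes r: "0 < r" and f: "\<And>t z w. t \<in> {0..1} \<Longrightarrow> cmod z = 1 \<Longrightarrow> cmod w = 1 \<Longrightarrow>
    (\<Sum>(u, v)\<in>torus_group r. monomial 3 \<alpha> (torus_point t (u * z) (v * w))) = poly f t"
  shows "2 * real r ^ 2 * (\<integral>x. monomial 3 \<alpha> x \<partial>sphere_measure 3) = moment_functional f"
proof -
  let ?S = "sphere_measure 3"
  have symm: "sphere_symmetry 3 (torus_rot u v)" if "(u, v) \<in> torus_group r" for u v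
    using torus_group_norms[OF r that] by (rule sphere_symmetry_torus_rot)
  have orbit_sum: "(\<Sum>(u, v)\<in>torus_group r. monomial 3 \<alpha> (torus_rot u v x)) = poly f (moment_map x)"
    if x: "x \<in> unit_sphere 3" for x
  proof -
    obtain z w where zw: "cmod z = 1" "cmod w = 1" "x = torus_point (moment_map x) z w"
      using unit_sphere_3_torus_point[OF x] by blast
    have "(\<Sum>(u, v)\<in>torus_group r. monomial 3 \<alpha> (torus_rot u v (torus_point (moment_map x) z w))) =
        poly f (moment_map x)"
      unfolding torus_rot_torus_point by (rule f[OF moment_map_bounds[OF x] zw(1,2)])
    then show ?thesis
      by (simp only: zw(3)[symmetric])
  qed
  have "2 * real r ^ 2 * (\<integral>x. monomial 3 \<alpha> x \<partial>?S) = (\<Sum>(u, v)\<in>torus_group r. \<integral>x. monomial 3 \<alpha> x \<partial>?S)"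
    by (simp add: card_torus_group[OF r] case_prod_unfold)
  also have "\<dots> = (\<Sum>(u, v)\<in>torus_group r. \<integral>x. monomial 3 \<alpha> (torus_rot u v x) \<partial>?S)"
    by (intro sum.cong refl)
       (auto simp only: integral_sphere_symmetry[OF symm monomial_measurable] case_prod_conv)
  also have "\<dots> = (\<integral>x. (\<Sum>(u, v)\<in>torus_group r. monomial 3 \<alpha> (torus_rot u v x)) \<partial>?S)"
    unfolding case_prod_unfold
    by (intro Bochner_Integration.integral_sum[symmetric] integrable_monomial_symmetry symm) simp
  also have "\<dots> = moment_functional f"
    unfolding moment_functional_def
    by (intro Bochner_Integration.integral_cong refl orbit_sum) (simp only: space_sphere_measure)
  finally show ?thesis .
qed

lemma null_sets_PiM_finite_sections:
  assumes i: "i \<le> n" and A: "A \<in> sets (lborel_PiM n)" and fin: "\<And>x. finite {y. x(i := y) \<in> A}"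
  shows "A \<in> null_sets (lborel_PiM n)"
proof -
  have section_null: "(\<integral>\<^sup>+y. indicator A (x(i := y)) \<partial>lborel) = 0" for x
  proof -
    have "(\<integral>\<^sup>+y. indicator A (x(i := y)) \<partial>lborel) = (\<integral>\<^sup>+y. indicator {y. x(i := y) \<in> A} y \<partial>lborel)"
      by (intro nn_integral_cong) (simp add: indicator_def)
    also have "\<dots> = emeasure lborel {y. x(i := y) \<in> A}"
      using finite_imp_closed[OF fin] by (intro nn_integral_indicator) auto
    also have "\<dots> = 0"
      by (rule emeasure_lborel_countable[OF countable_finite[OF fin]])
    finally show ?thesis .
  qed
  have "emeasure (lborel_PiM n) A = (\<integral>\<^sup>+x. indicator A x \<partial>lborel_PiM n)"
    using A by simp
  also have "\<dots> = (\<integral>\<^sup>+x. (\<integral>\<^sup>+y. indicator A (x(i := y)) \<partial>lborel) \<partial>(\<Pi>\<^sub>M i\<in>{..n} - {i}. lborel))"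
    using A by (intro nn_integral_PiM_section[OF i]) simp
  also have "\<dots> = 0"
    by (simp add: section_null)
  finally show ?thesis
    using A by auto
qed

lemma finite_quadratic_roots:
  fixes a b :: real
  assumes "a \<noteq> 0"
  shows "finite {y. a * y\<^sup>2 + b = 0}"
proof -
  have "finite {y. poly [:b, 0, a:] y = 0}"
    using assms by (intro poly_roots_finite) simp
  then show ?thesis
    by (simp add: power2_eq_square algebra_simps)
qed

lemma null_sets_moment_cone:
  "{x \<in> space (lborel_PiM 3). moment_map x = c * (\<Sum>i\<le>3. (x i)\<^sup>2)} \<in> null_sets (lborel_PiM 3)"
    (is "?N \<in> _")
proof -
  have N_sets: "?N \<in> sets (lborel_PiM 3)"
    by measurable
  show ?thesis
  proof (cases "c = 1")
    case True
    have "finite {y. x(2 := y) \<in> ?N}" for x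
      by (rule finite_subset[OF _ finite_quadratic_roots[of 1 "(x 3)\<^sup>2"]])
         (auto simp: True moment_map_def sum_atMost_3)
    then show ?thesis
      by (intro null_sets_PiM_finite_sections[OF _ N_sets, of 2]) auto
  next
    case False
    have "finite {y. x(0 := y) \<in> ?N}" for x
      using False
      by (intro finite_subset[OF _ finite_quadratic_roots[of "1 - c"
              "(x 1)\<^sup>2 - c * ((x 1)\<^sup>2 + (x 2)\<^sup>2 + (x 3)\<^sup>2)"]])
         (auto simp: moment_map_def sum_atMost_3 algebra_simps)
    then show ?thesis
      by (intro null_sets_PiM_finite_sections[OF _ N_sets, of 0]) auto
  qed
qed

lemma AE_moment_map_neq: "AE x in sphere_measure 3. moment_map x \<noteq> c"
proof (rule AE_sphere_measureI)
  show "AE x in lborel_PiM 3. x \<in> punctured_ball 3 \<longrightarrow> moment_map (radial_proj 3 x) \<noteq> c"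
  proof (rule AE_mp[OF AE_not_in[OF null_sets_moment_cone[of c]]], intro AE_I2 impI notI)
    fix x assume x: "x \<in> space (lborel_PiM 3)" "x \<in> punctured_ball 3"
      and notin: "x \<notin> {x \<in> space (lborel_PiM 3). moment_map x = c * (\<Sum>i\<le>3. (x i)\<^sup>2)}"
      and level: "moment_map (radial_proj 3 x) = c"
    have "moment_map (radial_proj 3 x) = moment_map x / (eucl_norm 3 x)\<^sup>2"
      by (simp add: moment_map_def radial_proj_def power_divide add_divide_distrib)
    then have "moment_map x = c * (eucl_norm 3 x)\<^sup>2"
      using level x(2) by (simp add: punctured_ball_def field_simps)
    then show False
      using x(1) notin by (simp add: eucl_norm_def sum_nonneg)
  qed
qed measurable

lemma integrable_poly_moment_map: "integrable (sphere_measure 3) (\<lambda>x. poly f (moment_map x))"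
proof -
  have cont: "continuous_on S (poly f)" for S
    by (intro continuous_intros)
  have "(\<lambda>x. poly f (moment_map x)) \<in> borel_measurable (lborel_PiM 3)"
    by (rule measurable_compose[OF moment_map_measurable borel_measurable_continuous_onI[OF cont]])
  moreover have "bounded (poly f ` {0..1})"
    by (rule compact_imp_bounded[OF compact_continuous_image[OF cont compact_Icc]])
  then obtain K where "\<forall>t\<in>{0..1}. \<bar>poly f t\<bar> \<le> K"
    by (auto simp: bounded_iff)
  ultimately show ?thesis
    using moment_map_bounds by (intro integrable_sphere_measure_bounded[where K = K]) blast+
qed

lemma positive_moment_functional: "positive_poly_functional moment_functional 0 1"
proof
  show "moment_functional (p + q) = moment_functional p + moment_functional q" for p q
    unfolding moment_functional_def poly_add
    by (intro Bochner_Integration.integral_add integrable_poly_moment_map)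
  show "moment_functional (smult c p) = c * moment_functional p" for c p
    by (simp add: moment_functional_def)
  fix p :: "real poly" assume p: "p \<noteq> 0" "\<And>t. t \<in> {0..1} \<Longrightarrow> 0 \<le> poly p t"
  interpret prob_space "sphere_measure 3"
    by (rule prob_space_sphere_measure)
  have nonneg: "AE x in sphere_measure 3. 0 \<le> poly p (moment_map x)"
    using p(2) moment_map_bounds by (intro AE_I2) (auto simp: space_sphere_measure)
  have "moment_functional p \<noteq> 0"
  proof
    assume "moment_functional p = 0"
    then have "AE x in sphere_measure 3. poly p (moment_map x) = 0"
      using integral_nonneg_eq_0_iff_AE[OF integrable_poly_moment_map nonneg]
      by (simp add: moment_functional_def)
    moreover have "AE x in sphere_measure 3. \<forall>c\<in>{c. poly p c = 0}. moment_map x \<noteq> c"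
      using poly_roots_finite[OF p(1)] AE_moment_map_neq by (subst AE_finite_all) auto
    ultimately have "AE x in sphere_measure 3. False"
      by eventually_elim blast
    then show False by simp
  qed
  moreover have "0 \<le> moment_functional p"
    unfolding moment_functional_def using nonneg by (rule integral_nonneg_AE)
  ultimately show "0 < moment_functional p" by simp
qed

definition torus_orbit :: "nat \<Rightarrow> real \<Rightarrow> (nat \<Rightarrow> real) set" where
  "torus_orbit r t = (\<lambda>(u, v). torus_point t u v) ` torus_group r"

lemma torus_point_eq_iff:
  "torus_point t z w = torus_point t z' w' \<longleftrightarrow> (t = 0 \<or> z = z') \<and> (t = 1 \<or> w = w')"
proof
  assume eq: "torus_point t z w = torus_point t z' w'"
  have "torus_point t z w i = torus_point t z' w' i" for i
    by (simp only: eq)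
  from this[of 0] this[of 1] this[of 2] this[of 3]
  show "(t = 0 \<or> z = z') \<and> (t = 1 \<or> w = w')"
    by (auto simp: complex_eq_iff)
qed (auto simp: torus_point_def)

lemma card_torus_orbit:
  assumes "0 < r" and "0 < t" "t < 1"
  shows "card (torus_orbit r t) = 2 * r\<^sup>2"
proof -
  have "inj_on (\<lambda>(u, v). torus_point t u v) (torus_group r)"
    using assms(2,3) by (auto simp: inj_on_def torus_point_eq_iff)
  then show ?thesis
    by (simp add: torus_orbit_def card_image card_torus_group[OF assms(1)])
qed

lemma card_torus_orbit_1:
  assumes "0 < r"
  shows "card (torus_orbit r 1) = 2 * r"
proof -
  have "torus_orbit r 1 = (\<lambda>u. torus_point 1 u 1) ` fst ` torus_group r"
    unfolding torus_orbit_def image_image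
    by (intro image_cong refl) (auto simp: torus_point_eq_iff)
  moreover have "inj (\<lambda>u. torus_point 1 u 1)"
    by (auto simp: inj_on_def torus_point_eq_iff)
  ultimately show ?thesis
    using assms by (simp add: card_image inj_on_subset proj_torus_group card_roots_unity_eq)
qed

lemma card_torus_orbit_0:
  assumes "0 < r"
  shows "card (torus_orbit r 0) = 2 * r"
proof -
  have "torus_orbit r 0 = (\<lambda>v. torus_point 0 1 v) ` snd ` torus_group r"
    unfolding torus_orbit_def image_image
    by (intro image_cong refl) (auto simp: torus_point_eq_iff)
  moreover have "inj (\<lambda>v. torus_point 0 1 v)"
    by (auto simp: inj_on_def torus_point_eq_iff)
  ultimately show ?thesis
    using assms by (simp add: card_image inj_on_subset proj_torus_group card_roots_unity_eq)
qed

lemma card_UN_torus_orbit: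
  assumes r: "0 < r" and A: "finite A" "A \<subseteq> {0<..<1}" and E: "E \<subseteq> {0, 1}"
  shows "card (\<Union>t\<in>A \<union> E. torus_orbit r t) = card A * (2 * r\<^sup>2) + card E * (2 * r)"
proof -
  have finE: "finite E"
    using E by (rule finite_subset) simp
  have disj: "A \<inter> E = {}"
    using A(2) E by fastforce
  have "card (\<Union>t\<in>A \<union> E. torus_orbit r t) = (\<Sum>t\<in>A \<union> E. card (torus_orbit r t))"
  proof (rule card_UN_disjoint)
    show "\<forall>t\<in>A \<union> E. finite (torus_orbit r t)"
      using finite_torus_group[OF r] by (simp add: torus_orbit_def)
    have "moment_map x = t" if "x \<in> torus_orbit r t" "t \<in> A \<union> E" for x t
      using that A(2) E torus_group_norms[OF r]
      by (auto simp: torus_orbit_def intro!: moment_map_torus_point)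
    then show "\<forall>t\<in>A \<union> E. \<forall>t'\<in>A \<union> E. t \<noteq> t' \<longrightarrow> torus_orbit r t \<inter> torus_orbit r t' = {}"
      by blast
  qed (use A(1) finE in simp)
  also have "\<dots> = (\<Sum>t\<in>A. card (torus_orbit r t)) + (\<Sum>t\<in>E. card (torus_orbit r t))"
    by (rule sum.union_disjoint[OF A(1) finE disj])
  also have "(\<Sum>t\<in>A. card (torus_orbit r t)) = (\<Sum>t\<in>A. 2 * r\<^sup>2)"
    using A(2) by (intro sum.cong refl card_torus_orbit[OF r]) auto
  also have "(\<Sum>t\<in>E. card (torus_orbit r t)) = (\<Sum>t\<in>E. 2 * r)"
    using E card_torus_orbit_0[OF r] card_torus_orbit_1[OF r] by (intro sum.cong refl) auto
  finally show ?thesis by simp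
qed

lemma integral_monomial_torus_orbits:
  assumes A: "A \<subseteq> {0..1}"
    and exact: "\<And>f. degree f < r \<Longrightarrow> moment_functional f = (\<Sum>t\<in>A. W t * poly f t)"
    and r: "0 < r" and \<alpha>: "(\<Sum>i\<le>3. \<alpha> i) < 2 * r"
  shows "(\<integral>x. monomial 3 \<alpha> x \<partial>sphere_measure 3) =
    (\<Sum>t\<in>A. \<Sum>(u, v)\<in>torus_group r. W t / (2 * real r ^ 2) * monomial 3 \<alpha> (torus_point t u v))"
proof -
  obtain f where "degree f < r" and f: "\<And>t z w. t \<in> {0..1} \<Longrightarrow> cmod z = 1 \<Longrightarrow> cmod w = 1 \<Longrightarrow>
      (\<Sum>(u, v)\<in>torus_group r. monomial 3 \<alpha> (torus_point t (u * z) (v * w))) = poly f t"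
    using sum_torus_group_monomial[OF r \<alpha>] by blast
  have "2 * real r ^ 2 * (\<integral>x. monomial 3 \<alpha> x \<partial>sphere_measure 3) = (\<Sum>t\<in>A. W t * poly f t)"
    by (simp only: integral_monomial_torus_group[OF r f] exact[OF \<open>degree f < r\<close>])
  also have "\<dots> = (\<Sum>t\<in>A. W t * (\<Sum>(u, v)\<in>torus_group r. monomial 3 \<alpha> (torus_point t u v)))"
  proof (intro sum.cong refl)
    fix t assume "t \<in> A"
    then have "t \<in> {0..1}"
      using A by blast
    from f[OF this norm_one norm_one]
    show "W t * poly f t = W t * (\<Sum>(u, v)\<in>torus_group r. monomial 3 \<alpha> (torus_point t u v))"
      by (simp only: mult_1_right)
  qed
  finally have "(\<integral>x. monomial 3 \<alpha> x \<partial>sphere_measure 3) =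
      (\<Sum>t\<in>A. W t * (\<Sum>(u, v)\<in>torus_group r. monomial 3 \<alpha> (torus_point t u v))) / (2 * real r ^ 2)"
    using r by (simp add: field_simps)
  then show ?thesis
    by (simp add: sum_divide_distrib sum_distrib_left case_prod_unfold)
qed

lemma torus_cubature:
  assumes A: "finite A" "A \<subseteq> {0..1}"
    and exact: "\<And>f. degree f \<le> s \<Longrightarrow> moment_functional f = (\<Sum>t\<in>A. W t * poly f t)"
  shows "\<exists>w. is_cubature 3 (2 * s + 1) (\<Union>t\<in>A. torus_orbit (s + 1) t) w"
proof -
  let ?G = "torus_group (s + 1)"
  define g where "g = (\<lambda>(t, u, v). torus_point t u v)"
  define h where "h = (\<lambda>(t, p :: complex \<times> complex). W t / (2 * real (s + 1) ^ 2))"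
  have "is_cubature 3 (2 * s + 1) (g ` (A \<times> ?G)) (\<lambda>p. \<Sum>t\<in>{t\<in>A \<times> ?G. g t = p}. h t)"
  proof (rule is_cubature_family)
    show "finite (A \<times> ?G)"
      using A finite_torus_group[of "s + 1"] by simp
    show "g ` (A \<times> ?G) \<subseteq> unit_sphere 3"
      using A(2) torus_group_norms[of "s + 1"] by (auto simp: g_def intro!: torus_point_in_sphere)
    fix \<alpha> assume "\<alpha> \<in> multi_indices 3 (2 * s + 1)"
    then have "(\<Sum>i\<le>3. \<alpha> i) < 2 * (s + 1)"
      by (simp add: multi_indices_def)
    from integral_monomial_torus_orbits[OF A(2) exact _ this]
    have "(\<integral>x. monomial 3 \<alpha> x \<partial>sphere_measure 3) =
        (\<Sum>t\<in>A. \<Sum>(u, v)\<in>?G. W t / (2 * real (s + 1) ^ 2) * monomial 3 \<alpha> (torus_point t u v))"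
      by simp
    also have "\<dots> = (\<Sum>t\<in>A. \<Sum>p\<in>?G. h (t, p) * monomial 3 \<alpha> (g (t, p)))"
      by (simp add: g_def h_def case_prod_unfold)
    finally show "(\<integral>x. monomial 3 \<alpha> x \<partial>sphere_measure 3) = (\<Sum>t\<in>A \<times> ?G. h t * monomial 3 \<alpha> (g t))"
      by (simp add: sum.cartesian_product)
  qed
  moreover have "g ` (A \<times> ?G) = (\<Union>t\<in>A. torus_orbit (s + 1) t)"
    by (force simp: g_def torus_orbit_def)
  ultimately show ?thesis by metis
qed

lemma exists_torus_cubature:
  assumes A: "finite A" "A \<subseteq> {0<..<1}" and E: "E \<subseteq> {0, 1}"
    and exact: "\<And>f. degree f \<le> s \<Longrightarrow> moment_functional f = (\<Sum>t\<in>A \<union> E. W t * poly f t)"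
  shows "\<exists>F w. is_cubature 3 (2 * s + 1) F w \<and>
    card F = card A * (2 * (s + 1)\<^sup>2) + card E * (2 * (s + 1))"
proof -
  have "finite (A \<union> E)"
    using A(1) finite_subset[OF E] by simp
  moreover have "A \<union> E \<subseteq> {0..1}"
    using A(2) E by fastforce
  ultimately have "\<exists>w. is_cubature 3 (2 * s + 1) (\<Union>t\<in>A \<union> E. torus_orbit (s + 1) t) w"
    using exact by (rule torus_cubature)
  then show ?thesis
    using card_UN_torus_orbit[OF _ A E, of "s + 1"] by auto
qed

lemma exists_cubature_S3_odd:
  assumes "odd s"
  shows "\<exists>F w. is_cubature 3 (2 * s + 1) F w \<and> card F = (s + 1) * (s\<^sup>2 + 3)"
proof -
  obtain m where m: "s = 2 * m + 1"
    using assms by (rule oddE)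
  obtain A W where A: "finite A" "A \<subseteq> {0<..<1}" "card A = m"
    and exact: "\<And>f. degree f \<le> s \<Longrightarrow> moment_functional f = (\<Sum>t\<in>A \<union> {0, 1}. W t * poly f t)"
    using positive_poly_functional.gauss_lobatto_quadrature[OF positive_moment_functional, of m] m by auto
  have count: "card A * (2 * (s + 1)\<^sup>2) + card {0, 1 :: real} * (2 * (s + 1)) = (s + 1) * (s\<^sup>2 + 3)"
    unfolding A(3) m by (simp add: power2_eq_square algebra_simps)
  show ?thesis
    using exists_torus_cubature[where s = s, OF A(1,2) _ exact] unfolding count by simp
qed

lemma exists_cubature_S3_even:
  assumes "even s"
  shows "\<exists>F w. is_cubature 3 (2 * s + 1) F w \<and> card F = (s + 1) * (s\<^sup>2 + s + 2)"
proof -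
  obtain m where m: "s = 2 * m"
    using assms by (rule evenE)
  obtain A W where A: "finite A" "A \<subseteq> {0<..<1}" "card A = m"
    and exact: "\<And>f. degree f \<le> s \<Longrightarrow> moment_functional f = (\<Sum>t\<in>A \<union> {0}. W t * poly f t)"
    using positive_poly_functional.gauss_radau_quadrature[OF positive_moment_functional, of m] m by auto
  have count: "card A * (2 * (s + 1)\<^sup>2) + card {0 :: real} * (2 * (s + 1)) = (s + 1) * (s\<^sup>2 + s + 2)"
    unfolding A(3) m by (simp add: power2_eq_square algebra_simps)
  show ?thesis
    using exists_torus_cubature[where s = s, OF A(1,2) _ exact] unfolding count by simp
qed

theorem corollary4p2:
  shows "(\<exists>N :: nat \<Rightarrow> nat.
      (\<forall>n. \<exists>F w. is_cubature n 7 F w \<and> card F = N n) \<and>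
      (\<exists>C :: real. \<forall>n\<ge>1. real (N n) \<le> C * real n ^ 4) \<and>
      (\<lambda>n. real (N n)) \<sim>[at_top] (\<lambda>n. 4 * real n ^ 4)) \<and>
    (\<forall>s :: nat. \<exists>F w. is_cubature 3 (2 * s + 1) F w \<and>
      card F = (if odd s then (s + 1) * (s ^ 2 + 3) else (s + 1) * (s ^ 2 + s + 2)))"
  using cubature_7_asymptotic exists_cubature_S3_odd exists_cubature_S3_even by simp

end
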